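(* Let $p>1$ and let $\psi:[0,1]\to\mathbb{R}$ be continuous with $\psi(0)<0$, $\psi(1)<0$, and $\psi(x_0)>0$ for some $x_0\in(0,1)$. Suppose that $$\inf_{v\in M_{\rm sym}(\psi)}\mathcal{E}_p(v)<c_p^p,\qquad c_p:=2\int_0^\infty\frac{dt}{(1+t^2)^{\frac32-\frac1{2p}}}.$$ Then there exists a minimizer $u\in M_{\rm sym}(\psi)$ of $\mathcal{E}_p$ in $M_{\rm sym}(\psi)$.
   Context: $\mathcal{E}_p(u):=\int_0^1|\kappa_u|^p\sqrt{1+(u')^2}\,dx$ with $\kappa_u=u''/(1+(u')^2)^{3/2}$. $M(\psi) := \{ v \in W^{2,p}(0,1)\cap W^{1,p}_0(0,1) : v \ge \psi \text{ on } [0,1]\}$ and $M_{\rm sym}(\psi) := \{ v\in M(\psi) : v(x)=v(1-x) \text{ for } x\in[0,1]\}$. *)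

theory Defs
  imports "HOL-Analysis.Analysis"
begin

text \<open>W^{2,p}(0,1), identified with continuous representatives: u is C^1 on [0,1],
  and u' = a + (integral of w) for some w in L^p(0,1) (i.e. u' absolutely continuous
  with second derivative w in L^p).\<close>
definition W2p :: "real \<Rightarrow> (real \<Rightarrow> real) \<Rightarrow> bool" where
  "W2p p u \<longleftrightarrow> (\<exists>a w.
      set_integrable lebesgue {0..1} w \<and>
      set_integrable lebesgue {0..1} (\<lambda>x. \<bar>w x\<bar> powr p) \<and>
      (\<forall>x\<in>{0..1}. (u has_real_derivative (a + (LINT t:{0..x}|lebesgue. w t))) (at x within {0..1})))"

definition W2p_W1p0 :: "real \<Rightarrow> (real \<Rightarrow> real) \<Rightarrow> bool" where
  "W2p_W1p0 p u \<longleftrightarrow> W2p p u \<and> u 0 = 0 \<and> u 1 = 0"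

definition curv :: "(real \<Rightarrow> real) \<Rightarrow> real \<Rightarrow> real" where
  "curv u x = deriv (deriv u) x / (1 + (deriv u x)\<^sup>2) powr (3/2)"

definition Ep :: "real \<Rightarrow> (real \<Rightarrow> real) \<Rightarrow> real" where
  "Ep p u = (LINT x:{0..1}|lebesgue. \<bar>curv u x\<bar> powr p * sqrt (1 + (deriv u x)\<^sup>2))"

definition Mset :: "real \<Rightarrow> (real \<Rightarrow> real) \<Rightarrow> (real \<Rightarrow> real) set" where
  "Mset p \<psi> = {v. W2p_W1p0 p v \<and> (\<forall>x\<in>{0..1}. v x \<ge> \<psi> x)}"

definition Msym :: "real \<Rightarrow> (real \<Rightarrow> real) \<Rightarrow> (real \<Rightarrow> real) set" where
  "Msym p \<psi> = {v \<in> Mset p \<psi>. \<forall>x\<in>{0..1}. v x = v (1 - x)}"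

definition cp :: "real \<Rightarrow> real" where
  "cp p = 2 * (LINT t:{0..}|lborel. 1 / (1 + t\<^sup>2) powr (3/2 - 1 / (2 * p)))"

end

theory Submission
  imports Defs "HOL-Complex_Analysis.Great_Picard"
begin

text \<open>Let \<open>G\<close> be the odd primitive of \<open>(1 + s\<^sup>2)\<close> to the power \<open>1/(2p) - 3/2\<close>; it increases to
  \<open>c\<^sub>p / 2\<close> at infinity, and the energy of \<open>u\<close> is the integral of \<open>|(G \<circ> u')'|\<close> to the power \<open>p\<close>.
  For symmetric \<open>u\<close> the slope satisfies \<open>u'(1 - x) = - u'(x)\<close>, so \<open>2 |G(u'(x))|\<close> is at most the total
  variation of \<open>G \<circ> u'\<close>, which by Jensen is at most the \<open>p\<close>-th root of the energy. An energy level below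
  \<open>c\<^sub>p\<close> to the power \<open>p\<close> therefore bounds the slopes along a minimising sequence uniformly; by
  Arzela--Ascoli they converge uniformly along a subsequence, and the energy, being convex in
  \<open>(G \<circ> u')'\<close>, is lower semicontinuous along it.\<close>

section \<open>Indefinite integrals\<close>

text \<open>The intervals on which the difference quotient at \<open>x\<close> is off by more than \<open>1 / (m + 1)\<close> form a Vitali
  cover of the exceptional set, and by Henstock's lemma fine disjoint families of them have small
  total length.\<close>

lemma negligible_not_has_derivative_indefinite_integral:
  fixes f :: "real \<Rightarrow> real"
  assumes f: "f integrable_on {a..b}"
  shows "negligible {x \<in> {a<..<b}. \<not> ((\<lambda>x. integral {a..x} f) has_real_derivative f x) (at x)}"
proof -
  define F where "F = (\<lambda>x. integral {a..x} f)"
  define bad where "bad = (\<lambda>m x y. y \<in> {a..b} \<and> y \<noteq> x \<and>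
    \<bar>y - x\<bar> < real (Suc m) * \<bar>F y - F x - f x * (y - x)\<bar>)"
  define S where "S = (\<lambda>m. {x \<in> {a<..<b}. \<forall>d>0. \<exists>y. \<bar>y - x\<bar> < d \<and> bad m x y})"
  have F_diff: "integral {x..y} f = F y - F x" if "a \<le> x" "x \<le> y" "y \<le> b" for x y
    using Henstock_Kurzweil_Integration.integral_combine[of a x y f] that
      integrable_on_subinterval[OF f, of a y] by (auto simp: F_def)
  have "negligible (S m)" for m
    unfolding negligible_outer_le
  proof (intro allI impI)
    fix e :: real assume "e > 0"
    then have pos: "e / real (Suc m) > 0" by simp
    have "f integrable_on cbox a b" using f by simp
    from Henstock_lemma[OF this pos] obtain \<gamma> where \<gamma>: "gauge \<gamma>"
      and small: "\<And>p. \<lbrakk>p tagged_partial_division_of cbox a b; \<gamma> fine p\<rbrakk> \<Longrightarrow>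
             (\<Sum>(x,k)\<in>p. norm (measure lborel k *\<^sub>R f x - integral k f)) < e / real (Suc m)"
      by blast
    define K where "K = {(x, y). x \<in> S m \<and> bad m x y \<and> {min x y..max x y} \<subseteq> \<gamma> x}"
    define c where "c = (\<lambda>(x::real, y). (x + y) / 2)"
    define r where "r = (\<lambda>(x::real, y). \<bar>x - y\<bar> / 2)"
    have cb: "cball (c i) (r i) = {min (fst i) (snd i)..max (fst i) (snd i)}" for i
      by (cases i) (auto simp: c_def r_def cball_eq_atLeastAtMost min_def max_def field_simps)
    have rpos: "0 < r i" if "i \<in> K" for i
      using that by (auto simp: K_def r_def bad_def)
    have vit: "\<exists>i. i \<in> K \<and> x \<in> cball (c i) (r i) \<and> r i < d" if x: "x \<in> S m" and d: "0 < d" for x d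
    proof -
      obtain \<delta> where \<delta>: "\<delta> > 0" "ball x \<delta> \<subseteq> \<gamma> x"
        using \<gamma> by (meson gauge_def openE)
      have "min \<delta> d > 0" using \<delta> d by simp
      then obtain y where y: "\<bar>y - x\<bar> < min \<delta> d" "bad m x y"
        using x unfolding S_def by blast
      have "{min x y..max x y} \<subseteq> ball x \<delta>"
        using y by (auto simp: dist_real_def)
      then have "(x, y) \<in> K" using x y \<delta> by (auto simp: K_def)
      moreover have "x \<in> cball (c (x,y)) (r (x,y))" unfolding cb by auto
      moreover have "r (x,y) < d" using y by (auto simp: r_def)
      ultimately show ?thesis by blast
    qed
    obtain C where C: "countable C" "C \<subseteq> K"
      and disj: "pairwise (\<lambda>i j. disjnt (cball (c i) (r i)) (cball (c j) (r j))) C"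
      and neg: "negligible (S m - (\<Union>i\<in>C. cball (c i) (r i)))"
      using Vitali_covering_theorem_cballs[of K r "S m" c, OF rpos vit] by blast
    have fin: "measure lebesgue (\<Union>i\<in>P. cball (c i) (r i)) \<le> e" if P: "P \<subseteq> C" "finite P" for P
    proof -
      define q where "q = (\<lambda>i. (fst i, cball (c i) (r i))) ` P"
      have inj: "inj_on (\<lambda>i. (fst i, cball (c i) (r i))) P"
      proof (rule inj_onI, rule ccontr)
        fix i j assume ij: "i \<in> P" "j \<in> P" "(fst i, cball (c i) (r i)) = (fst j, cball (c j) (r j))" "i \<noteq> j"
        then have "disjnt (cball (c i) (r i)) (cball (c j) (r j))"
          using disj P unfolding pairwise_def by blast
        then show False using ij rpos[of j] P C by (auto simp: disjnt_def)
      qed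
      have part: "q tagged_partial_division_of cbox a b"
        unfolding tagged_partial_division_of_def cbox_interval[of a b]
      proof (intro conjI allI impI; (elim conjE)?)
        show "finite q" using P by (simp add: q_def)
      next
        fix x k assume "(x, k) \<in> q"
        then obtain i where i: "i \<in> P" "x = fst i" "k = cball (c i) (r i)" by (auto simp: q_def)
        then have "i \<in> K" using P C by auto
        then have *: "fst i \<in> {a..b}" "snd i \<in> {a..b}" by (auto simp: K_def S_def bad_def)
        show "x \<in> k" using i unfolding cb by auto
        show "k \<subseteq> {a..b}" using i * unfolding cb by auto
        show "\<exists>a b. k = cbox a b" using i unfolding cb cbox_interval by blast
      next
        fix x1 k1 x2 k2 assume "(x1, k1) \<in> q" "(x2, k2) \<in> q" and ne: "(x1, k1) \<noteq> (x2, k2)"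
        then obtain i j where i: "i \<in> P" "x1 = fst i" "k1 = cball (c i) (r i)"
          and j: "j \<in> P" "x2 = fst j" "k2 = cball (c j) (r j)" by (auto simp: q_def)
        have "i \<noteq> j" using ne i j by auto
        then have "disjnt k1 k2" unfolding i(3) j(3) using disj i(1) j(1) P(1) by (meson pairwiseD subsetD)
        then show "interior k1 \<inter> interior k2 = {}"
          using interior_subset[of k1] interior_subset[of k2] unfolding disjnt_def by blast
      qed
      have fine: "\<gamma> fine q"
        unfolding fine_def
      proof (intro allI impI ballI, clarify)
        fix x k t assume "(x, k) \<in> q" and t: "t \<in> k"
        then obtain i where i: "i \<in> P" "x = fst i" "k = cball (c i) (r i)" by (auto simp: q_def)
        then have "i \<in> K" using P C by auto
        then show "t \<in> \<gamma> x" using t unfolding i cb K_def by auto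
      qed
      have meas: "measure lebesgue (cball (c i) (r i)) \<le>
          real (Suc m) * norm (measure lborel (cball (c i) (r i)) *\<^sub>R f (fst i) - integral (cball (c i) (r i)) f)"
        if i: "i \<in> P" for i
      proof -
        obtain x y where xy: "i = (x, y)" by fastforce
        have "(x, y) \<in> K" using i xy P C by auto
        then have *: "x \<in> {a..b}" "y \<in> {a..b}" "bad m x y" by (auto simp: K_def S_def bad_def)
        have "integral {min x y..max x y} f = (if x \<le> y then F y - F x else F x - F y)"
          using F_diff[of x y] F_diff[of y x] * by (auto simp: min_def max_def)
        then have "norm (measure lborel {min x y..max x y} *\<^sub>R f x - integral {min x y..max x y} f)
            = \<bar>F y - F x - f x * (y - x)\<bar>"
          by (auto simp: min_def max_def abs_minus_commute algebra_simps)
        moreover have "measure lebesgue {min x y..max x y} = \<bar>y - x\<bar>" by auto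
        ultimately show ?thesis
          using * unfolding cb xy bad_def by auto
      qed
      have "measure lebesgue (\<Union>i\<in>P. cball (c i) (r i)) \<le> (\<Sum>i\<in>P. measure lebesgue (cball (c i) (r i)))"
        using P by (intro measure_UNION_le) auto
      also have "\<dots> \<le> (\<Sum>i\<in>P. real (Suc m) * norm (measure lborel (cball (c i) (r i)) *\<^sub>R f (fst i) - integral (cball (c i) (r i)) f))"
        by (intro sum_mono meas)
      also have "\<dots> = real (Suc m) * (\<Sum>(x,k)\<in>q. norm (measure lborel k *\<^sub>R f x - integral k f))"
        unfolding q_def by (subst sum.reindex[OF inj]) (simp add: sum_distrib_left o_def)
      also have "\<dots> \<le> real (Suc m) * (e / real (Suc m))"
        using small[OF part fine] by (intro mult_left_mono) auto
      finally show ?thesis by simp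
    qed
    have U: "(\<Union>i\<in>C. cball (c i) (r i)) \<in> lmeasurable \<and> measure lebesgue (\<Union>i\<in>C. cball (c i) (r i)) \<le> e"
      using fmeasurable_UN_bound[OF C(1) lmeasurable_cball fin] measure_UN_bound[OF C(1) lmeasurable_cball fin]
      by blast
    show "\<exists>T. S m \<subseteq> T \<and> T \<in> lmeasurable \<and> measure lebesgue T \<le> e"
    proof (intro exI conjI)
      let ?U = "\<Union>i\<in>C. cball (c i) (r i)"
      show "S m \<subseteq> ?U \<union> (S m - ?U)" by blast
      show "?U \<union> (S m - ?U) \<in> lmeasurable" using U neg
        by (meson fmeasurable.Un negligible_imp_measurable)
      have "measure lebesgue (?U \<union> (S m - ?U)) = measure lebesgue ?U"
        using U neg by (intro measure_Un_null_set) (auto simp: negligible_iff_null_sets)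
      then show "measure lebesgue (?U \<union> (S m - ?U)) \<le> e" using U by simp
    qed
  qed
  then have "negligible (\<Union>m. S m)"
    by (intro negligible_countable_Union) auto
  moreover have "{x \<in> {a<..<b}. \<not> (F has_real_derivative f x) (at x)} \<subseteq> (\<Union>m. S m)"
  proof (rule subsetI, rule ccontr)
    fix x assume x: "x \<in> {x \<in> {a<..<b}. \<not> (F has_real_derivative f x) (at x)}" "x \<notin> (\<Union>m. S m)"
    have "(F has_real_derivative f x) (at x)"
      unfolding has_field_derivative_def has_derivative_at_alt
    proof (intro conjI allI impI)
      show "bounded_linear ((*) (f x))" by (rule bounded_linear_mult_right)
      fix e :: real assume "e > 0"
      then obtain m where m: "inverse (real (Suc m)) < e" using reals_Archimedean by blast
      obtain d where d: "d > 0" "\<And>y. \<bar>y - x\<bar> < d \<Longrightarrow> \<not> bad m x y"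
        using x unfolding S_def by blast
      obtain d' where d': "d' > 0" "\<And>y. \<bar>y - x\<bar> < d' \<Longrightarrow> y \<in> {a..b}"
        using x by (intro that[of "min (x - a) (b - x)"]) auto
      show "\<exists>d>0. \<forall>y. norm (y - x) < d \<longrightarrow> norm (F y - F x - f x * (y - x)) \<le> e * norm (y - x)"
      proof (intro exI[of _ "min d d'"] conjI allI impI)
        fix y assume y: "norm (y - x) < min d d'"
        show "norm (F y - F x - f x * (y - x)) \<le> e * norm (y - x)"
        proof (cases "y = x")
          case False
          then have "real (Suc m) * \<bar>F y - F x - f x * (y - x)\<bar> \<le> \<bar>y - x\<bar>"
            using d(2)[of y] d'(2)[of y] y by (auto simp: bad_def)
          then have "\<bar>F y - F x - f x * (y - x)\<bar> \<le> inverse (real (Suc m)) * \<bar>y - x\<bar>"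
            by (simp add: field_simps)
          also have "\<dots> \<le> e * \<bar>y - x\<bar>" using m by (intro mult_right_mono) auto
          finally show ?thesis by simp
        qed auto
      qed (use d d' in auto)
    qed
    then show False using x by auto
  qed
  ultimately show ?thesis unfolding F_def by (rule negligible_subset)
qed

lemma increment_bound_from_local:
  fixes F N :: "real \<Rightarrow> real"
  assumes d: "d > 0"
    and loc: "\<And>s t. a \<le> s \<Longrightarrow> s \<le> t \<Longrightarrow> t \<le> b \<Longrightarrow> t - s < d \<Longrightarrow> \<bar>F t - F s\<bar> \<le> N t - N s"
    and "a \<le> s" "s \<le> t" "t \<le> b"
  shows "\<bar>F t - F s\<bar> \<le> N t - N s"
proof -
  have *: "\<bar>F t - F s\<bar> \<le> N t - N s"
    if "a \<le> s" "s \<le> t" "t \<le> b" "t - s < real (Suc n) * d" for n s t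
    using that
  proof (induction n arbitrary: s t)
    case 0
    then show ?case using loc by simp
  next
    case (Suc n)
    define m where "m = t - (t - s) / real (Suc (Suc n))"
    have m1: "t - m < d" unfolding m_def using Suc.prems by (simp add: field_simps)
    have m2: "m \<le> t" unfolding m_def using Suc.prems by simp
    have ms: "m - s = (t - s) * (real (Suc n) / real (Suc (Suc n)))"
      unfolding m_def by (simp add: field_simps)
    have m3: "s \<le> m" using ms Suc.prems by (smt (verit) mult_nonneg_nonneg divide_nonneg_nonneg of_nat_0_le_iff)
    have "m - s < real (Suc n) * d"
    proof -
      have "(t - s) * (real (Suc n) / real (Suc (Suc n))) < (real (Suc (Suc n)) * d) * (real (Suc n) / real (Suc (Suc n)))"
        using Suc.prems by (intro mult_strict_right_mono) auto
      then show ?thesis unfolding ms by (simp add: mult.commute)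
    qed
    then have "\<bar>F m - F s\<bar> \<le> N m - N s" using Suc.IH[of s m] Suc.prems m2 m3 by linarith
    moreover have "\<bar>F t - F m\<bar> \<le> N t - N m" using loc[of m t] Suc.prems m1 m2 m3 by linarith
    ultimately show ?case by linarith
  qed
  obtain n where "(t - s) / d < real n" using reals_Archimedean2 by blast
  then have "t - s < real (Suc n) * d" using d by (simp add: field_simps)
  then show ?thesis using * assms by blast
qed

lemma mean_value_composition:
  fixes \<phi> \<phi>' v :: "real \<Rightarrow> real"
  assumes der: "\<And>s. (\<phi> has_real_derivative \<phi>' s) (at s)"
    and v: "continuous_on {s..t} v" and "s \<le> t"
  shows "\<exists>r\<in>{s..t}. \<phi> (v t) - \<phi> (v s) = \<phi>' (v r) * (v t - v s)"
proof -
  have conn: "connected (v ` {s..t})" using v by (intro connected_continuous_image) auto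
  have st: "v s \<in> v ` {s..t}" "v t \<in> v ` {s..t}" using \<open>s \<le> t\<close> by auto
  consider "v s = v t" | "v s < v t" | "v t < v s" by linarith
  then show ?thesis
  proof cases
    case 1
    then show ?thesis using \<open>s \<le> t\<close> by (intro bexI[of _ s]) auto
  next
    case 2
    obtain z where z: "v s < z" "z < v t" "\<phi> (v t) - \<phi> (v s) = (v t - v s) * \<phi>' z"
      using MVT2[OF 2, of \<phi> \<phi>'] der by blast
    then have "z \<in> v ` {s..t}" using connected_contains_Icc[OF conn st] by auto
    with z show ?thesis by (auto simp: mult.commute)
  next
    case 3
    obtain z where z: "v t < z" "z < v s" "\<phi> (v s) - \<phi> (v t) = (v s - v t) * \<phi>' z"
      using MVT2[OF 3, of \<phi> \<phi>'] der by blast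
    then have "z \<in> v ` {s..t}" using connected_contains_Icc[OF conn st(2,1)] by auto
    then obtain r where "r \<in> {s..t}" "z = v r" by blast
    with z show ?thesis by (intro bexI[of _ r]) (auto simp: algebra_simps)
  qed
qed

lemma chain_rule_indefinite_integral:
  fixes \<phi> \<phi>' v w :: "real \<Rightarrow> real"
  assumes w: "w absolutely_integrable_on {a..b}"
    and v: "\<And>x. x \<in> {a..b} \<Longrightarrow> v x = c + integral {a..x} w"
    and der: "\<And>s. (\<phi> has_real_derivative \<phi>' s) (at s)"
    and cont: "continuous_on UNIV \<phi>'"
  shows "(\<lambda>t. \<phi>' (v t) * w t) absolutely_integrable_on {a..b}"
    and "x \<in> {a..b} \<Longrightarrow> \<phi> (v x) = \<phi> (v a) + integral {a..x} (\<lambda>t. \<phi>' (v t) * w t)"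
proof -
  have wi: "w integrable_on {a..b}" and wa: "(\<lambda>t. \<bar>w t\<bar>) integrable_on {a..b}"
    using w by (auto simp: absolutely_integrable_on_def)
  have cv: "continuous_on {a..b} v"
    using indefinite_integral_continuous_1[OF wi] v
    by (subst continuous_on_cong[OF refl v]) (auto intro!: continuous_intros)
  define h where "h = (\<lambda>t. \<phi>' (v t))"
  have ch: "continuous_on {a..b} h"
    unfolding h_def by (rule continuous_on_compose2[OF cont cv]) auto
  have ai: "(\<lambda>t. h t * w t) absolutely_integrable_on {a..b}"
  proof (rule absolutely_integrable_bounded_measurable_product_real[OF _ _ _ w])
    show "h \<in> borel_measurable (lebesgue_on {a..b})"
      using ch by (intro continuous_imp_measurable_on_sets_lebesgue) auto
    show "bounded (h ` {a..b})"
      using ch by (intro compact_imp_bounded compact_continuous_image) auto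
  qed auto
  then show "(\<lambda>t. \<phi>' (v t) * w t) absolutely_integrable_on {a..b}" by (simp add: h_def)
  have hwi: "(\<lambda>t. h t * w t) integrable_on {a..b}"
    using ai by (auto simp: absolutely_integrable_on_def)
  define F where "F = (\<lambda>x. \<phi> (v x) - integral {a..x} (\<lambda>t. h t * w t))"
  define N where "N = (\<lambda>x. integral {a..x} (\<lambda>t. \<bar>w t\<bar>))"
  have split: "integral {a..t} f - integral {a..s} f = integral {s..t} f"
    if "f integrable_on {a..b}" "a \<le> s" "s \<le> t" "t \<le> b" for f :: "real \<Rightarrow> real" and s t
    using Henstock_Kurzweil_Integration.integral_combine[of a s t f] that
      integrable_on_subinterval[OF that(1), of a t] by auto
  assume x: "x \<in> {a..b}"
  have bound: "\<bar>F x - F a\<bar> \<le> e * N x - e * N a" if e: "e > 0" for e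
  proof -
    have "uniformly_continuous_on {a..b} h" using ch by (intro compact_uniformly_continuous) auto
    then obtain d where d: "d > 0" "\<And>s t. s \<in> {a..b} \<Longrightarrow> t \<in> {a..b} \<Longrightarrow> dist t s < d \<Longrightarrow> dist (h t) (h s) < e"
      using e unfolding uniformly_continuous_on_def by metis
    show ?thesis
    proof (rule increment_bound_from_local[OF d(1)])
      fix s t assume st: "a \<le> s" "s \<le> t" "t \<le> b" "t - s < d"
      have sub: "{s..t} \<subseteq> {a..b}" using st by auto
      obtain r where r: "r \<in> {s..t}" "\<phi> (v t) - \<phi> (v s) = \<phi>' (v r) * (v t - v s)"
        using mean_value_composition[OF der continuous_on_subset[OF cv sub] st(2)] by blast
      have i1: "w integrable_on {s..t}" "(\<lambda>t. h t * w t) integrable_on {s..t}" "(\<lambda>t. \<bar>w t\<bar>) integrable_on {s..t}"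
        using integrable_on_subinterval[OF _ sub] wi hwi wa by auto
      have "v t - v s = integral {s..t} w" using v[of t] v[of s] split[OF wi, of s t] st by auto
      then have "F t - F s = integral {s..t} (\<lambda>\<tau>. h r * w \<tau> - h \<tau> * w \<tau>)"
        using r split[OF hwi, of s t] st i1 unfolding F_def h_def
        by (subst Henstock_Kurzweil_Integration.integral_diff) (auto intro: integrable_on_mult_right)
      also have "norm \<dots> \<le> integral {s..t} (\<lambda>\<tau>. e * \<bar>w \<tau>\<bar>)"
      proof (rule integral_norm_bound_integral)
        fix \<tau> assume "\<tau> \<in> {s..t}"
        then have "dist (h r) (h \<tau>) < e" using r(1) st by (intro d(2)) (auto simp: dist_real_def)
        then show "norm (h r * w \<tau> - h \<tau> * w \<tau>) \<le> e * \<bar>w \<tau>\<bar>"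
          by (auto simp: dist_real_def abs_mult left_diff_distrib[symmetric] intro!: mult_right_mono)
      qed (use i1 in \<open>auto intro!: Henstock_Kurzweil_Integration.integrable_diff integrable_on_mult_right\<close>)
      finally show "\<bar>F t - F s\<bar> \<le> e * N t - e * N s"
        using split[OF wa, of s t] st by (simp add: N_def right_diff_distrib[symmetric])
    qed (use x in auto)
  qed
  have "\<bar>F x - F a\<bar> \<le> 0"
  proof (rule field_le_epsilon)
    fix e :: real assume "e > 0"
    have Nx: "N x \<ge> 0" unfolding N_def by (rule integral_nonneg)
      (use x integrable_on_subinterval[OF wa, of a x] in auto)
    have "\<bar>F x - F a\<bar> \<le> e / (N x + 1) * N x - e / (N x + 1) * N a"
      using \<open>e > 0\<close> Nx by (intro bound) auto
    also have "\<dots> \<le> e" using \<open>e > 0\<close> Nx by (simp add: N_def field_simps)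
    finally show "\<bar>F x - F a\<bar> \<le> 0 + e" by simp
  qed
  then show "\<phi> (v x) = \<phi> (v a) + integral {a..x} (\<lambda>t. \<phi>' (v t) * w t)"
    by (simp add: F_def h_def)
qed

section \<open>Lower semicontinuity of the \<open>p\<close>-energy\<close>

lemma powr_gt_tangent:
  fixes p t m :: real
  assumes "p > 1" "t \<ge> 0" "m > 0" "t \<noteq> m"
  shows "m powr p + p * m powr (p - 1) * (t - m) < t powr p"
proof (cases "t = 0")
  case True
  have "m powr (p - 1) * m = m powr p" using assms by (simp add: powr_mult_base' mult.commute powr_diff)
  moreover have "m powr p > 0" using assms by simp
  moreover have "m powr p < p * m powr p" using assms \<open>m powr p > 0\<close> by simp
  ultimately show ?thesis using True by (simp add: algebra_simps)
next
  case False
  then have t: "t > 0" using assms by simp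
  have d: "((\<lambda>s. s powr p) has_real_derivative p * s powr (p - 1)) (at s)" if "s > 0" for s
    using has_real_derivative_powr[OF that, of p] by simp
  show ?thesis
  proof (cases "t < m")
    case True
    obtain z where z: "t < z" "z < m" "m powr p - t powr p = (m - t) * (p * z powr (p - 1))"
      using MVT2[OF True, of "\<lambda>s. s powr p" "\<lambda>s. p * s powr (p - 1)"] d t by auto
    have "z powr (p - 1) < m powr (p - 1)" using z t assms by (intro powr_less_mono2) auto
    then have "(m - t) * (p * z powr (p - 1)) < (m - t) * (p * m powr (p - 1))"
      using True assms by (intro mult_strict_left_mono) auto
    then show ?thesis using z by (simp add: algebra_simps)
  next
    case False
    then have mt: "m < t" using assms by simp
    obtain z where z: "m < z" "z < t" "t powr p - m powr p = (t - m) * (p * z powr (p - 1))"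
      using MVT2[OF mt, of "\<lambda>s. s powr p" "\<lambda>s. p * s powr (p - 1)"] d assms by auto
    have "m powr (p - 1) < z powr (p - 1)" using z assms by (intro powr_less_mono2) auto
    then have "(t - m) * (p * m powr (p - 1)) < (t - m) * (p * z powr (p - 1))"
      using mt assms by (intro mult_strict_left_mono) auto
    then show ?thesis using z by (simp add: algebra_simps)
  qed
qed

lemma powr_ge_tangent:
  fixes p t m :: real
  assumes "p > 1" "t \<ge> 0" "m > 0"
  shows "m powr p + p * m powr (p - 1) * (t - m) \<le> t powr p"
  using powr_gt_tangent[OF assms] by (cases "t = m") auto

definition powr_gap :: "real \<Rightarrow> real \<Rightarrow> real \<Rightarrow> real" where
  "powr_gap p a b = (\<bar>a\<bar> powr p + \<bar>b\<bar> powr p) / 2 - \<bar>(a + b) / 2\<bar> powr p"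

lemma powr_gap_pos:
  assumes "p > 1" "a \<noteq> b"
  shows "powr_gap p a b > 0"
proof (cases "a + b = 0")
  case True
  then have "\<bar>a\<bar> powr p + \<bar>b\<bar> powr p > 0" using assms by (intro add_pos_pos) auto
  then show ?thesis using True by (simp add: powr_gap_def)
next
  case False
  define m where "m = \<bar>(a + b) / 2\<bar>"
  have m: "m > 0" using False by (simp add: m_def)
  define q where "q = p * m powr (p - 1)"
  have q: "q > 0" using m assms by (simp add: q_def)
  have tri: "\<bar>a\<bar> + \<bar>b\<bar> \<ge> 2 * m" by (simp add: m_def)
  have *: "m powr p + q * (\<bar>a\<bar> - m) \<le> \<bar>a\<bar> powr p" "m powr p + q * (\<bar>b\<bar> - m) \<le> \<bar>b\<bar> powr p"
    using powr_ge_tangent[OF assms(1) _ m] unfolding q_def by auto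
  have eq: "m powr p + q * (\<bar>a\<bar> - m) + (m powr p + q * (\<bar>b\<bar> - m)) = 2 * m powr p + q * (\<bar>a\<bar> + \<bar>b\<bar> - 2 * m)"
    by (simp add: algebra_simps)
  have nn: "q * (\<bar>a\<bar> + \<bar>b\<bar> - 2 * m) \<ge> 0" using tri q by simp
  have "\<bar>a\<bar> \<noteq> m \<or> \<bar>b\<bar> \<noteq> m" using assms(2) by (auto simp: m_def abs_if split: if_splits)
  then have "m powr p + q * (\<bar>a\<bar> - m) < \<bar>a\<bar> powr p \<or> m powr p + q * (\<bar>b\<bar> - m) < \<bar>b\<bar> powr p"
    using powr_gt_tangent[OF assms(1) _ m] unfolding q_def by auto
  then have "2 * m powr p < \<bar>a\<bar> powr p + \<bar>b\<bar> powr p" using * eq nn by linarith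
  then show ?thesis by (simp add: powr_gap_def m_def)
qed

lemma powr_gap_nonneg: "p > 1 \<Longrightarrow> powr_gap p a b \<ge> 0"
  using powr_gap_pos[of p a b] by (cases "a = b") (auto simp: powr_gap_def)

lemma abs_diff_le_powr_gap:
  fixes p e :: real
  assumes p: "p > 1" and e: "e > 0"
  obtains C where "C \<ge> 0"
    "\<And>a b. \<bar>a - b\<bar> \<le> e * (1 + \<bar>a\<bar> powr p + \<bar>b\<bar> powr p) + C * powr_gap p a b"
proof -
  define R where "R = (2 / e) powr (1 / (p - 1))"
  define S where "S = ({-R..R} \<times> {-R..R}) \<inter> {z. e \<le> \<bar>fst z - snd z\<bar>}"
  have S: "compact S"
    unfolding S_def by (intro compact_Int_closed compact_Times compact_Icc closed_Collect_le continuous_intros)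
  have inS: "(a, b) \<in> S" if ab: "e * (1 + \<bar>a\<bar> powr p + \<bar>b\<bar> powr p) < \<bar>a - b\<bar>" for a b
  proof -
    have bnd: "M \<le> R" if M: "M = max \<bar>a\<bar> \<bar>b\<bar>" for M
    proof (cases "M = 0")
      case False
      then have M0: "M > 0" using M by auto
      have "e * M powr p \<le> e * (\<bar>a\<bar> powr p + \<bar>b\<bar> powr p)" using M e by (intro mult_left_mono) (auto simp: max_def)
      also have "\<dots> < \<bar>a - b\<bar>" using ab e by (simp add: algebra_simps)
      also have "\<dots> \<le> 2 * M" using M by auto
      finally have "e * (M * M powr (p - 1)) < 2 * M" using M0 by (simp add: powr_diff)
      then have "M powr (p - 1) < 2 / e" using M0 e by (simp add: field_simps)
      then have "(M powr (p - 1)) powr (1 / (p - 1)) \<le> R" unfolding R_def using p by (intro powr_mono2) auto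
      then show ?thesis using p M0 by (simp add: powr_powr)
    qed (simp add: R_def)
    have "0 \<le> e * (\<bar>a\<bar> powr p + \<bar>b\<bar> powr p)" using e by simp
    then have "e \<le> \<bar>a - b\<bar>" using ab by (simp add: algebra_simps)
    then show ?thesis using bnd[OF refl] by (auto simp: S_def)
  qed
  show thesis
  proof (cases "S = {}")
    case True
    show ?thesis by (rule that[of 0]) (use inS True in \<open>auto simp: not_less[symmetric]\<close>)
  next
    case False
    have "continuous_on S (\<lambda>z. powr_gap p (fst z) (snd z))"
      unfolding powr_gap_def using p by (intro continuous_intros continuous_on_powr') auto
    then obtain z where z: "z \<in> S" "\<And>y. y \<in> S \<Longrightarrow> powr_gap p (fst z) (snd z) \<le> powr_gap p (fst y) (snd y)"
      using continuous_attains_inf[OF S False] by blast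
    define g where "g = powr_gap p (fst z) (snd z)"
    have g: "g > 0" unfolding g_def using z(1) e p by (intro powr_gap_pos) (auto simp: S_def)
    have R0: "R \<ge> 0" by (simp add: R_def)
    show ?thesis
    proof (rule that[of "2 * R / g"])
      show "2 * R / g \<ge> 0" using g R0 by simp
      fix a b
      show "\<bar>a - b\<bar> \<le> e * (1 + \<bar>a\<bar> powr p + \<bar>b\<bar> powr p) + 2 * R / g * powr_gap p a b"
      proof (cases "e * (1 + \<bar>a\<bar> powr p + \<bar>b\<bar> powr p) < \<bar>a - b\<bar>")
        case True
        then have ab: "(a, b) \<in> S" by (rule inS)
        then have "\<bar>a - b\<bar> \<le> 2 * R" by (auto simp: S_def)
        also have "\<dots> = 2 * R / g * g" using g by simp
        also have "\<dots> \<le> 2 * R / g * powr_gap p a b"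
          using z(2)[OF ab] g R0 unfolding g_def by (intro mult_left_mono) auto
        also have "\<dots> \<le> e * (1 + \<bar>a\<bar> powr p + \<bar>b\<bar> powr p) + 2 * R / g * powr_gap p a b"
          using e by (simp add: add_nonneg_nonneg)
        finally show ?thesis .
      next
        case False
        then show ?thesis using g R0 powr_gap_nonneg[OF p, of a b] by (smt (verit) divide_nonneg_pos mult_nonneg_nonneg)
      qed
    qed
  qed
qed

lemma integrable_Fatou:
  fixes f :: "nat \<Rightarrow> 'a \<Rightarrow> real"
  assumes f: "\<And>n. integrable M (f n)" and nn: "\<And>n x. 0 \<le> f n x"
    and g: "g \<in> borel_measurable M" and lim: "AE x in M. (\<lambda>n. f n x) \<longlonglongrightarrow> g x"
    and bound: "\<And>n. (\<integral>x. f n x \<partial>M) \<le> B n" and B: "B \<longlonglongrightarrow> L"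
  shows "integrable M g" "(\<integral>x. g x \<partial>M) \<le> L"
proof -
  have AEnn: "AE x in M. 0 \<le> g x"
    using lim by eventually_elim (auto intro: LIMSEQ_le_const nn)
  have B0: "0 \<le> B n" for n
    using order_trans[OF Bochner_Integration.integral_nonneg bound] nn .
  have L0: "0 \<le> L" using B B0 by (intro LIMSEQ_le_const[OF B]) auto
  have m: "f n \<in> borel_measurable M" for n using f by auto
  have "(\<integral>\<^sup>+x. ennreal (g x) \<partial>M) = (\<integral>\<^sup>+x. liminf (\<lambda>n. ennreal (f n x)) \<partial>M)"
  proof (rule nn_integral_cong_AE)
    show "AE x in M. ennreal (g x) = liminf (\<lambda>n. ennreal (f n x))"
      using lim
    proof eventually_elim
      case (elim x)
      then have "(\<lambda>n. ennreal (f n x)) \<longlonglongrightarrow> ennreal (g x)" by (rule tendsto_ennrealI)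
      then show ?case by (simp add: lim_imp_Liminf)
    qed
  qed
  also have "\<dots> \<le> liminf (\<lambda>n. \<integral>\<^sup>+x. ennreal (f n x) \<partial>M)"
    using m by (intro nn_integral_liminf) auto
  also have "\<dots> \<le> liminf (\<lambda>n. ennreal (B n))"
    using bound by (intro Liminf_mono always_eventually allI)
      (simp add: nn_integral_eq_integral[OF f] nn ennreal_leI)
  also have "\<dots> = ennreal L"
    using B by (intro lim_imp_Liminf tendsto_ennrealI) auto
  finally have le: "(\<integral>\<^sup>+x. ennreal (g x) \<partial>M) \<le> ennreal L" .
  show int: "integrable M g"
    using le AEnn by (intro integrableI_nonneg g) (auto simp: top.not_eq_extremum[symmetric] top_unique)
  show "(\<integral>x. g x \<partial>M) \<le> L"
    using le L0 by (simp add: nn_integral_eq_integral[OF int AEnn] integral_nonneg_AE[OF AEnn])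
qed

lemma le_one_plus_powr:
  fixes t :: real
  assumes "p > 1" "0 \<le> t" shows "t \<le> 1 + t powr p"
proof (cases "t \<le> 1")
  case False
  then have "t powr 1 \<le> t powr p" using assms by (intro powr_mono) auto
  then show ?thesis using False by simp
qed (use assms in \<open>smt (verit) powr_ge_zero\<close>)

lemma integrable_powr_gap:
  assumes "p > 1"
    and f: "f \<in> borel_measurable M" "integrable M (\<lambda>x. \<bar>f x\<bar> powr p)"
    and g: "g \<in> borel_measurable M" "integrable M (\<lambda>x. \<bar>g x\<bar> powr p)"
  shows "integrable M (\<lambda>x. \<bar>(f x + g x) / 2\<bar> powr p)"
    "integrable M (\<lambda>x. powr_gap p (f x) (g x))"
proof -
  have [measurable]: "f \<in> borel_measurable M" "g \<in> borel_measurable M" by fact+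
  show 1: "integrable M (\<lambda>x. \<bar>(f x + g x) / 2\<bar> powr p)"
  proof (rule Bochner_Integration.integrable_bound)
    show "integrable M (\<lambda>x. (\<bar>f x\<bar> powr p + \<bar>g x\<bar> powr p) / 2)" using f g by auto
    show "(\<lambda>x. \<bar>(f x + g x) / 2\<bar> powr p) \<in> borel_measurable M" by measurable
    show "AE x in M. norm (\<bar>(f x + g x) / 2\<bar> powr p) \<le> norm ((\<bar>f x\<bar> powr p + \<bar>g x\<bar> powr p) / 2)"
      using powr_gap_nonneg[OF \<open>p > 1\<close>] by (intro AE_I2) (auto simp: powr_gap_def)
  qed
  show "integrable M (\<lambda>x. powr_gap p (f x) (g x))"
    unfolding powr_gap_def using f g 1 by auto
qed

lemma integrable_of_powr_integrable:
  fixes f :: "'a \<Rightarrow> real"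
  assumes "finite_measure M" "p > 1" "f \<in> borel_measurable M" "integrable M (\<lambda>x. \<bar>f x\<bar> powr p)"
  shows "integrable M f"
proof (rule Bochner_Integration.integrable_bound)
  interpret finite_measure M by fact
  show "integrable M (\<lambda>x. 1 + \<bar>f x\<bar> powr p)" using assms by auto
  show "AE x in M. norm (f x) \<le> norm (1 + \<bar>f x\<bar> powr p)"
    using le_one_plus_powr[OF \<open>p > 1\<close>] by (intro AE_I2) auto
qed fact

lemma powr_gap_Cauchy_limit:
  fixes W :: "nat \<Rightarrow> 'a \<Rightarrow> real"
  assumes fin: "finite_measure M" and p: "p > 1"
    and meas: "\<And>n. W n \<in> borel_measurable M"
    and int: "\<And>n. integrable M (\<lambda>x. \<bar>W n x\<bar> powr p)"
    and bound: "\<And>n. (\<integral>x. \<bar>W n x\<bar> powr p \<partial>M) \<le> B n" and B: "B \<longlonglongrightarrow> L"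
    and gap: "\<And>e. e > 0 \<Longrightarrow> \<exists>N. \<forall>i\<ge>N. \<forall>j\<ge>N. (\<integral>x. powr_gap p (W i x) (W j x) \<partial>M) < e"
  obtains w where "w \<in> borel_measurable M" "integrable M (\<lambda>x. \<bar>w x\<bar> powr p)"
    "(\<integral>x. \<bar>w x\<bar> powr p \<partial>M) \<le> L" "(\<lambda>n. \<integral>x. \<bar>W n x - w x\<bar> \<partial>M) \<longlonglongrightarrow> 0"
proof -
  interpret finite_measure M by fact
  have intW: "integrable M (W n)" for n
    using integrable_of_powr_integrable[OF fin p meas int] .
  obtain Q where "Q > 0" "\<And>n. norm (B n) \<le> Q"
    using convergent_imp_Bseq[OF convergentI[OF B]] unfolding Bseq_def by blast
  then have Q: "Q > 0" "\<And>n. B n \<le> Q" using abs_le_D1 by auto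
  have cauchy: "\<exists>N. \<forall>i\<ge>N. \<forall>j\<ge>N. (\<integral>x. norm (W i x - W j x) \<partial>M) < e" if e: "e > 0" for e
  proof -
    define \<epsilon> where "\<epsilon> = e / 2 / (measure M (space M) + 2 * Q)"
    have den: "measure M (space M) + 2 * Q > 0" using Q by (simp add: add_nonneg_pos)
    then have "\<epsilon> > 0" using e by (simp add: \<epsilon>_def)
    from abs_diff_le_powr_gap[OF p this] obtain C where C: "C \<ge> 0"
      "\<And>a b. \<bar>a - b\<bar> \<le> \<epsilon> * (1 + \<bar>a\<bar> powr p + \<bar>b\<bar> powr p) + C * powr_gap p a b" by blast
    have "e / 2 / (C + 1) > 0" using e C by simp
    from gap[OF this] obtain N where N:
      "\<And>i j. i \<ge> N \<Longrightarrow> j \<ge> N \<Longrightarrow> (\<integral>x. powr_gap p (W i x) (W j x) \<partial>M) < e / 2 / (C + 1)" by blast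
    have "(\<integral>x. norm (W i x - W j x) \<partial>M) < e" if ij: "i \<ge> N" "j \<ge> N" for i j
    proof -
      note ig = integrable_powr_gap(2)[OF p meas int meas int, of i j]
      have "(\<integral>x. norm (W i x - W j x) \<partial>M) \<le>
          (\<integral>x. \<epsilon> * (1 + \<bar>W i x\<bar> powr p + \<bar>W j x\<bar> powr p) + C * powr_gap p (W i x) (W j x) \<partial>M)"
        using C ig int intW by (intro integral_mono) auto
      also have "\<dots> = \<epsilon> * (measure M (space M) + (\<integral>x. \<bar>W i x\<bar> powr p \<partial>M) + (\<integral>x. \<bar>W j x\<bar> powr p \<partial>M))
          + C * (\<integral>x. powr_gap p (W i x) (W j x) \<partial>M)"
        using ig int by simp
      also have "\<dots> \<le> \<epsilon> * (measure M (space M) + Q + Q) + C * (e / 2 / (C + 1))"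
        using \<open>\<epsilon> > 0\<close> C N[OF ij] bound[of i] bound[of j] Q(2)[of i] Q(2)[of j]
        by (intro add_mono mult_left_mono) auto
      also have "\<epsilon> * (measure M (space M) + Q + Q) = e / 2" unfolding \<epsilon>_def using den by (simp add: field_simps)
      also have "C * (e / 2 / (C + 1)) < e / 2" using C e by (simp add: field_simps)
      finally show ?thesis by simp
    qed
    then show ?thesis by blast
  qed
  obtain r where r: "strict_mono r" "AE x in M. Cauchy (\<lambda>i. W (r i) x)"
    using cauchy_L1_AE_cauchy_subseq[of M W, OF intW cauchy] by blast
  define w where "w = (\<lambda>x. lim (\<lambda>i. W (r i) x))"
  have w[measurable]: "w \<in> borel_measurable M" unfolding w_def using meas by measurable
  have lim: "AE x in M. (\<lambda>i. W (r i) x) \<longlonglongrightarrow> w x"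
    using r(2) by eventually_elim (simp add: w_def Cauchy_convergent_iff convergent_LIMSEQ_iff)
  have limp: "AE x in M. (\<lambda>i. \<bar>W (r i) x\<bar> powr p) \<longlonglongrightarrow> \<bar>w x\<bar> powr p"
    using lim by eventually_elim (use p in \<open>auto intro!: tendsto_powr' tendsto_rabs\<close>)
  have wp: "integrable M (\<lambda>x. \<bar>w x\<bar> powr p)" "(\<integral>x. \<bar>w x\<bar> powr p \<partial>M) \<le> L"
    using integrable_Fatou[of M "\<lambda>n x. \<bar>W (r n) x\<bar> powr p" "\<lambda>x. \<bar>w x\<bar> powr p" "\<lambda>n. B (r n)" L]
      int limp bound LIMSEQ_subseq_LIMSEQ[OF B r(1)] by (auto simp: o_def)
  have L1: "(\<lambda>n. \<integral>x. \<bar>W n x - w x\<bar> \<partial>M) \<longlonglongrightarrow> 0"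
  proof (rule LIMSEQ_I)
    fix e :: real assume "e > 0"
    then have "e / 2 > 0" by simp
    from cauchy[OF this] obtain N where N:
      "\<And>i j. i \<ge> N \<Longrightarrow> j \<ge> N \<Longrightarrow> (\<integral>x. norm (W i x - W j x) \<partial>M) < e / 2" by blast
    have "norm ((\<integral>x. \<bar>W n x - w x\<bar> \<partial>M) - 0) < e" if n: "n \<ge> N" for n
    proof -
      have "(\<integral>x. \<bar>W n x - w x\<bar> \<partial>M) \<le> e / 2"
      proof (rule integrable_Fatou(2)[where f = "\<lambda>i x. \<bar>W n x - W (r (i + N)) x\<bar>" and B = "\<lambda>_. e / 2"])
        show "integrable M (\<lambda>x. \<bar>W n x - W (r (i + N)) x\<bar>)" for i using intW by auto
        show "(\<lambda>x. \<bar>W n x - w x\<bar>) \<in> borel_measurable M" using meas by measurable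
        show "AE x in M. (\<lambda>i. \<bar>W n x - W (r (i + N)) x\<bar>) \<longlonglongrightarrow> \<bar>W n x - w x\<bar>"
          using lim
        proof eventually_elim
          case (elim x)
          from LIMSEQ_ignore_initial_segment[OF this, of N] show ?case by (intro tendsto_intros)
        qed
        show "(\<integral>x. \<bar>W n x - W (r (i + N)) x\<bar> \<partial>M) \<le> e / 2" for i
          using N[of n "r (i + N)"] n seq_suble[OF r(1), of "i + N"] by auto
      qed auto
      moreover have "(\<integral>x. \<bar>W n x - w x\<bar> \<partial>M) \<ge> 0" by simp
      ultimately show ?thesis using \<open>e > 0\<close> by simp
    qed
    then show "\<exists>N. \<forall>n\<ge>N. norm ((\<integral>x. \<bar>W n x - w x\<bar> \<partial>M) - 0) < e" by blast
  qed
  show thesis using that[OF w wp L1] .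
qed

text \<open>Near-minimisers of the \<open>p\<close>-energy among functions whose primitive is uniformly close to \<open>I\<close>
  have small midpoint gap by convexity, which replaces weak compactness of \<open>L\<^sup>p\<close>.\<close>
lemma powr_energy_lower_semicontinuous:
  fixes w :: "nat \<Rightarrow> real \<Rightarrow> real"
  assumes p: "p > 1"
    and w: "\<And>n. w n absolutely_integrable_on {a..b}"
    and wp: "\<And>n. (\<lambda>x. \<bar>w n x\<bar> powr p) absolutely_integrable_on {a..b}"
    and E: "\<And>n. integral {a..b} (\<lambda>x. \<bar>w n x\<bar> powr p) \<le> E n" and EL: "E \<longlonglongrightarrow> L"
    and I: "uniform_limit {a..b} (\<lambda>n x. integral {a..x} (w n)) I sequentially"
  obtains v where "v absolutely_integrable_on {a..b}" "(\<lambda>x. \<bar>v x\<bar> powr p) absolutely_integrable_on {a..b}"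
    "\<And>x. x \<in> {a..b} \<Longrightarrow> integral {a..x} v = I x" "integral {a..b} (\<lambda>x. \<bar>v x\<bar> powr p) \<le> L"
proof -
  define M where "M = lebesgue_on {a..b}"
  have fin: "finite_measure M"
    unfolding M_def by (rule finite_measureI) (simp add: emeasure_restrict_space emeasure_lborel_Icc_eq)
  interpret finite_measure M by fact
  have abs_iff: "f absolutely_integrable_on {a..b} \<longleftrightarrow> integrable M f" for f :: "real \<Rightarrow> real"
    unfolding M_def set_integrable_def by (simp add: integrable_restrict_space)
  have int_eq: "integral\<^sup>L M f = integral {a..b} f" if "integrable M f" for f :: "real \<Rightarrow> real"
    using that unfolding M_def by (rule lebesgue_integral_eq_integral) auto
  define J where "J = (\<lambda>f. \<integral>x. \<bar>f x\<bar> powr p \<partial>M)"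
  define K where "K = (\<lambda>m. {f. integrable M f \<and> integrable M (\<lambda>x. \<bar>f x\<bar> powr p) \<and>
     (\<forall>x\<in>{a..b}. \<bar>integral {a..x} f - I x\<bar> \<le> 1 / real (Suc m))})"
  have K_mono: "K m \<subseteq> K n" if "n \<le> m" for m n
  proof -
    have "1 / real (Suc m) \<le> 1 / real (Suc n)" using that by (intro divide_left_mono) auto
    then show ?thesis unfolding K_def by (auto intro: order_trans)
  qed
  have sub_int: "f integrable_on {a..x}" if "integrable M f" "x \<in> {a..b}" for f :: "real \<Rightarrow> real" and x
    using that abs_iff[of f] set_lebesgue_integral_eq_integral(1)[of "{a..b}" f]
      integrable_on_subinterval[of f "{a..b}" a x] by auto
  have K_mid: "(\<lambda>x. (f x + g x) / 2) \<in> K m" if f: "f \<in> K m" and g: "g \<in> K m" for f g m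
  proof -
    have "\<bar>integral {a..x} (\<lambda>x. (f x + g x) / 2) - I x\<bar> \<le> 1 / real (Suc m)" if x: "x \<in> {a..b}" for x
    proof -
      have "integral {a..x} (\<lambda>x. (f x + g x) / 2) = (integral {a..x} f + integral {a..x} g) / 2"
        using sub_int[of f x] sub_int[of g x] f g x
        by (simp add: K_def Henstock_Kurzweil_Integration.integral_add)
      moreover have "\<bar>integral {a..x} f - I x\<bar> \<le> 1 / real (Suc m)" "\<bar>integral {a..x} g - I x\<bar> \<le> 1 / real (Suc m)"
        using f g x by (auto simp: K_def)
      ultimately show ?thesis unfolding abs_le_iff by argo
    qed
    then show ?thesis
      using f g integrable_powr_gap(1)[OF p, of f M g] by (auto simp: K_def)
  qed
  define d where "d = (\<lambda>m. Inf (J ` K m))"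
  have J0: "J f \<ge> 0" for f unfolding J_def by simp
  have bdd: "bdd_below (J ` K m)" for m by (rule bdd_belowI[of _ 0]) (auto simp: J0)
  have evK: "\<forall>\<^sub>F n in sequentially. w n \<in> K m" for m
  proof -
    have "1 / real (Suc m) > 0" by simp
    from uniform_limitD[OF I this] show ?thesis
      by eventually_elim (use w wp in \<open>auto simp: K_def abs_iff dist_real_def intro: less_imp_le\<close>)
  qed
  have neK: "K m \<noteq> {}" for m using eventually_happens[OF evK[of m]] by auto
  have dL: "d m \<le> L" for m
  proof (rule tendsto_lowerbound[OF EL _ sequentially_bot])
    show "\<forall>\<^sub>F n in sequentially. d m \<le> E n"
      using evK[of m]
    proof eventually_elim
      case (elim n)
      then have "d m \<le> J (w n)" unfolding d_def by (intro cInf_lower bdd) auto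
      also have "J (w n) \<le> E n" using E[of n] wp[of n] by (simp add: J_def int_eq abs_iff)
      finally show ?case .
    qed
  qed
  have d_inc: "incseq d"
    unfolding incseq_def d_def using K_mono neK bdd by (auto intro!: cInf_superset_mono)
  obtain l where l: "d \<longlonglongrightarrow> l" "\<And>m. d m \<le> l"
    using incseq_convergent[OF d_inc, of L] dL by blast
  have lL: "l \<le> L" using LIMSEQ_le_const2[OF l(1)] dL by blast
  have "\<exists>f\<in>K m. J f < d m + 1 / real (Suc m)" for m
    using cInf_lessD[of "J ` K m" "d m + 1 / real (Suc m)"] neK[of m] unfolding d_def by auto
  then obtain W where W: "\<And>m. W m \<in> K m" "\<And>m. J (W m) < d m + 1 / real (Suc m)" by metis
  have lim0: "(\<lambda>m. 1 / real (Suc m)) \<longlonglongrightarrow> 0" using lim_inverse_n' LIMSEQ_Suc by blast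
  have limB: "(\<lambda>m. d m + 1 / real (Suc m)) \<longlonglongrightarrow> l" using tendsto_add[OF l(1) lim0] by simp
  have Wm: "W m \<in> borel_measurable M" "integrable M (W m)" "integrable M (\<lambda>x. \<bar>W m x\<bar> powr p)" for m
    using W(1)[of m] by (auto simp: K_def)
  have gap: "\<exists>N. \<forall>i\<ge>N. \<forall>j\<ge>N. (\<integral>x. powr_gap p (W i x) (W j x) \<partial>M) < e" if e: "e > 0" for e
  proof -
    have "(\<lambda>m. l + 1 / real (Suc m) - d m) \<longlonglongrightarrow> l + 0 - l" by (intro tendsto_intros lim0 l)
    then have "\<forall>\<^sub>F m in sequentially. l + 1 / real (Suc m) - d m < e" using e by (intro order_tendstoD(2)) auto
    then obtain N where N: "l + 1 / real (Suc N) - d N < e" by (auto simp: eventually_sequentially)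
    have "(\<integral>x. powr_gap p (W i x) (W j x) \<partial>M) < e" if ij: "i \<ge> N" "j \<ge> N" for i j
    proof -
      have "(\<lambda>x. (W i x + W j x) / 2) \<in> K N" using K_mid W(1) K_mono ij by blast
      then have 1: "d N \<le> J (\<lambda>x. (W i x + W j x) / 2)" unfolding d_def by (intro cInf_lower bdd) auto
      have 2: "(\<integral>x. powr_gap p (W i x) (W j x) \<partial>M) = (J (W i) + J (W j)) / 2 - J (\<lambda>x. (W i x + W j x) / 2)"
        unfolding powr_gap_def J_def using Wm integrable_powr_gap(1)[OF p, of "W i" M "W j"] by simp
      have JW: "J (W k) \<le> l + 1 / real (Suc N)" if "k \<ge> N" for k
      proof -
        have "1 / real (Suc k) \<le> 1 / real (Suc N)" using that by (intro divide_left_mono) auto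
        then show ?thesis using W(2)[of k] l(2)[of k] by linarith
      qed
      show ?thesis using N 1 2 JW[OF ij(1)] JW[OF ij(2)] by argo
    qed
    then show ?thesis by blast
  qed
  have JB: "(\<integral>x. \<bar>W n x\<bar> powr p \<partial>M) \<le> d n + 1 / real (Suc n)" for n
    using W(2)[of n] by (simp add: J_def)
  obtain v where v: "v \<in> borel_measurable M" "integrable M (\<lambda>x. \<bar>v x\<bar> powr p)"
    "(\<integral>x. \<bar>v x\<bar> powr p \<partial>M) \<le> l" "(\<lambda>n. \<integral>x. \<bar>W n x - v x\<bar> \<partial>M) \<longlonglongrightarrow> 0"
    using powr_gap_Cauchy_limit[OF fin p Wm(1) Wm(3) JB limB gap] by blast
  have vi: "integrable M v" using integrable_of_powr_integrable[OF fin p v(1,2)] .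
  show thesis
  proof (rule that)
    show "v absolutely_integrable_on {a..b}" "(\<lambda>x. \<bar>v x\<bar> powr p) absolutely_integrable_on {a..b}"
      using vi v by (auto simp: abs_iff)
    show "integral {a..b} (\<lambda>x. \<bar>v x\<bar> powr p) \<le> L" using v lL by (simp add: int_eq[symmetric])
    fix x assume x: "x \<in> {a..b}"
    have "(\<lambda>n. integral {a..x} (W n)) \<longlonglongrightarrow> I x"
    proof (rule LIM_zero_cancel, rule Lim_null_comparison[OF _ lim0])
      show "\<forall>\<^sub>F n in sequentially. norm (integral {a..x} (W n) - I x) \<le> 1 / real (Suc n)"
        using W(1) x by (auto simp: K_def)
    qed
    moreover have "(\<lambda>n. integral {a..x} (W n)) \<longlonglongrightarrow> integral {a..x} v"
    proof (rule LIM_zero_cancel, rule Lim_null_comparison[OF _ v(4)], rule always_eventually, rule allI)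
      fix n
      have ad: "integrable M (\<lambda>x. \<bar>W n x - v x\<bar>)" using vi Wm by auto
      have "norm (integral {a..x} (W n) - integral {a..x} v) = norm (integral {a..x} (\<lambda>x. W n x - v x))"
        using sub_int[OF vi x] sub_int[OF Wm(2) x] by (simp add: Henstock_Kurzweil_Integration.integral_diff)
      also have "\<dots> \<le> integral {a..x} (\<lambda>x. \<bar>W n x - v x\<bar>)"
        using sub_int[OF vi x] sub_int[OF Wm(2) x] sub_int[OF ad x]
        by (intro integral_norm_bound_integral) (auto intro: Henstock_Kurzweil_Integration.integrable_diff)
      also have "\<dots> \<le> integral {a..b} (\<lambda>x. \<bar>W n x - v x\<bar>)"
        using sub_int[OF ad x] sub_int[OF ad, of b] x by (intro integral_subset_le) auto
      also have "\<dots> = (\<integral>x. \<bar>W n x - v x\<bar> \<partial>M)" using ad by (simp add: int_eq)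
      finally show "norm (integral {a..x} (W n) - integral {a..x} v) \<le> (\<integral>x. \<bar>W n x - v x\<bar> \<partial>M)" .
    qed
    ultimately show "integral {a..x} v = I x" using LIMSEQ_unique by blast
  qed
qed

lemma powr_integral_le_integral_powr:
  fixes f :: "real \<Rightarrow> real"
  assumes p: "p > 1" and f: "f absolutely_integrable_on {0..1}"
    and fp: "(\<lambda>x. \<bar>f x\<bar> powr p) absolutely_integrable_on {0..1}"
  shows "(integral {0..1} (\<lambda>x. \<bar>f x\<bar>)) powr p \<le> integral {0..1} (\<lambda>x. \<bar>f x\<bar> powr p)"
proof -
  have i: "(\<lambda>x. \<bar>f x\<bar>) integrable_on {0..1}" "(\<lambda>x. \<bar>f x\<bar> powr p) integrable_on {0..1}"
    using f fp by (auto simp: absolutely_integrable_on_def)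
  define m where "m = integral {0..1} (\<lambda>x. \<bar>f x\<bar>)"
  have m0: "m \<ge> 0" unfolding m_def by (intro integral_nonneg i) auto
  show ?thesis
  proof (cases "m = 0")
    case True
    then show ?thesis using i by (auto simp: m_def[symmetric] intro!: integral_nonneg)
  next
    case False
    then have m: "m > 0" using m0 by simp
    have h: "((\<lambda>x. m powr p + p * m powr (p - 1) * (\<bar>f x\<bar> - m)) has_integral
        m powr p + p * m powr (p - 1) * (m - m)) {0..1}"
    proof -
      have c: "((\<lambda>x. c) has_integral c) {0..1::real}" for c :: real
        using has_integral_const_real[of c 0 1] by simp
      show ?thesis
        unfolding m_def[symmetric]
        by (intro has_integral_add has_integral_mult_right has_integral_diff c)
          (use integrable_integral[OF i(1)] in \<open>simp add: m_def\<close>)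
    qed
    have "m powr p + p * m powr (p - 1) * (m - m) \<le> integral {0..1} (\<lambda>x. \<bar>f x\<bar> powr p)"
      by (rule has_integral_le[OF h integrable_integral[OF i(2)]])
        (use powr_ge_tangent[OF p _ m] in auto)
    then show ?thesis by (simp add: m_def)
  qed
qed

lemma le_eps_powr:
  fixes t e p :: real
  assumes "p > 1" "e > 0" "t \<ge> 0"
  shows "t \<le> e * t powr p + (1 / e) powr (1 / (p - 1))"
proof (cases "t \<le> (1 / e) powr (1 / (p - 1))")
  case True
  then show ?thesis using assms by (simp add: add_increasing)
next
  case False
  have t: "t > 0" using False assms by (smt (verit) powr_ge_zero)
  have "((1 / e) powr (1 / (p - 1))) powr (p - 1) \<le> t powr (p - 1)"
    using False assms by (intro powr_mono2) auto
  then have "1 / e \<le> t powr (p - 1)" using assms by (simp add: powr_powr)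
  then have "t * 1 \<le> t * (e * t powr (p - 1))" using assms t by (intro mult_left_mono) (auto simp: field_simps)
  also have "\<dots> = e * t powr p" using t by (simp add: powr_diff)
  finally show ?thesis by (simp add: add_increasing2)
qed

lemma equicontinuous_indefinite_integral:
  fixes w :: "real \<Rightarrow> real"
  assumes p: "p > 1" and e: "e > 0" and w: "w absolutely_integrable_on {a..b}"
    and wp: "(\<lambda>x. \<bar>w x\<bar> powr p) absolutely_integrable_on {a..b}"
    and C: "integral {a..b} (\<lambda>x. \<bar>w x\<bar> powr p) \<le> C"
    and xy: "x \<in> {a..b}" "y \<in> {a..b}"
  shows "\<bar>integral {a..x} w - integral {a..y} w\<bar> \<le> e * C + (1 / e) powr (1 / (p - 1)) * \<bar>x - y\<bar>"
proof -
  define R where "R = (1 / e) powr (1 / (p - 1))"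
  have i: "w integrable_on {a..b}" "(\<lambda>x. \<bar>w x\<bar> powr p) integrable_on {a..b}"
    using w wp by (auto simp: absolutely_integrable_on_def)
  have *: "\<bar>integral {a..t} w - integral {a..s} w\<bar> \<le> e * C + R * (t - s)"
    if st: "a \<le> s" "s \<le> t" "t \<le> b" for s t
  proof -
    have sub: "{s..t} \<subseteq> {a..b}" using st by auto
    have i': "w integrable_on {s..t}" "(\<lambda>x. \<bar>w x\<bar> powr p) integrable_on {s..t}"
      using i integrable_on_subinterval[OF _ sub] by auto
    have "integral {a..t} w - integral {a..s} w = integral {s..t} w"
      using Henstock_Kurzweil_Integration.integral_combine[of a s t w] st
        integrable_on_subinterval[OF i(1), of a t] by auto
    also have "norm \<dots> \<le> integral {s..t} (\<lambda>x. e * \<bar>w x\<bar> powr p + R)"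
      using i' le_eps_powr[OF p e] unfolding R_def
      by (intro integral_norm_bound_integral Henstock_Kurzweil_Integration.integrable_add integrable_on_mult_right) auto
    also have "\<dots> = e * integral {s..t} (\<lambda>x. \<bar>w x\<bar> powr p) + R * (t - s)"
      using i' st by (subst Henstock_Kurzweil_Integration.integral_add) (auto intro: integrable_on_mult_right)
    also have "integral {s..t} (\<lambda>x. \<bar>w x\<bar> powr p) \<le> integral {a..b} (\<lambda>x. \<bar>w x\<bar> powr p)"
      using i i' sub by (intro integral_subset_le) auto
    also note C
    finally show ?thesis using e by simp
  qed
  show ?thesis
    using *[of x y] *[of y x] xy unfolding R_def[symmetric] by (cases "x \<le> y") (auto simp: abs_minus_commute)
qed

section \<open>The elastic energy of a graph\<close>

definition bend_weight :: "real \<Rightarrow> real \<Rightarrow> real" where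
  "bend_weight p s = 1 / (1 + s\<^sup>2) powr (3/2 - 1 / (2 * p))"

lemma one_plus_square_pos: "1 + s\<^sup>2 > (0::real)"
  by (simp add: add_pos_nonneg)

lemma bend_weight_pos: "bend_weight p s > 0"
  using one_plus_square_pos[of s] by (simp add: bend_weight_def)

lemma bend_weight_minus: "bend_weight p (- s) = bend_weight p s"
  by (simp add: bend_weight_def)

lemma bend_weight_antimono:
  assumes "p > 1" "\<bar>s\<bar> \<le> \<bar>t\<bar>"
  shows "bend_weight p t \<le> bend_weight p s"
proof -
  have "1 / (2 * p) \<le> 1 / 2" using assms by simp
  then have "3/2 - 1 / (2 * p) \<ge> 0" by linarith
  moreover have "1 + s\<^sup>2 \<le> 1 + t\<^sup>2" using assms by (simp add: abs_le_square_iff)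
  ultimately have "(1 + s\<^sup>2) powr (3/2 - 1 / (2 * p)) \<le> (1 + t\<^sup>2) powr (3/2 - 1 / (2 * p))"
    by (intro powr_mono2) auto
  then show ?thesis
    unfolding bend_weight_def using one_plus_square_pos[of s] one_plus_square_pos[of t]
    by (intro divide_left_mono mult_pos_pos) auto
qed

lemma continuous_on_bend_weight: "continuous_on A (bend_weight p)"
  unfolding bend_weight_def using one_plus_square_pos
  by (intro continuous_intros) (auto simp: less_imp_neq[symmetric] powr_eq_0_iff)

lemma bend_weight_primitive:
  assumes p: "p > 1" and c: "cp p > 0"
  obtains G where "\<And>s. (G has_real_derivative bend_weight p s) (at s)" "\<And>s. G (- s) = - G s"
    "strict_mono G" "\<And>A. A < cp p / 2 \<Longrightarrow> \<exists>S\<ge>0. A < G S"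
proof -
  have "\<exists>F. \<forall>x :: real. - \<infinity> < ereal x \<longrightarrow> ereal x < \<infinity> \<longrightarrow> (F has_vector_derivative bend_weight p x) (at x)"
    using continuous_on_bend_weight[of UNIV p]
    by (intro einterval_antiderivative) (auto simp: continuous_on_eq_continuous_at)
  then obtain F where F: "\<And>x. (F has_real_derivative bend_weight p x) (at x)"
    by (auto simp: has_real_derivative_iff_has_vector_derivative)
  define G where "G = (\<lambda>x. F x - F 0)"
  have G: "(G has_real_derivative bend_weight p s) (at s)" for s
    unfolding G_def using F[of s] by (auto intro!: derivative_eq_intros)
  have odd: "G (- s) = - G s" for s
  proof -
    have "((\<lambda>s. G s + G (- s)) has_real_derivative 0) (at s)" for s
    proof -
      have "((\<lambda>s. G (- s)) has_real_derivative bend_weight p (- s) * - 1) (at s)"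
        by (rule DERIV_chain2[where f = G and g = uminus, OF G]) (auto intro!: derivative_eq_intros)
      from DERIV_add[OF G[of s] this] show ?thesis by (simp add: bend_weight_minus)
    qed
    then have "G s + G (- s) = G 0 + G (- 0)" using DERIV_isconst_all by blast
    then show ?thesis by (simp add: G_def)
  qed
  have mono: "strict_mono G"
    by (rule strict_monoI, rule DERIV_pos_imp_increasing) (use G bend_weight_pos in blast)+
  have int: "set_integrable lborel {0..} (bend_weight p)"
  proof (rule ccontr)
    assume "\<not> ?thesis"
    then have "cp p = 0"
      unfolding cp_def set_lebesgue_integral_def set_integrable_def bend_weight_def
      by (simp add: not_integrable_integral_eq)
    then show False using c by simp
  qed
  have "((\<lambda>b. LINT t:{0..b}|lborel. bend_weight p t) \<longlongrightarrow> (LINT t:{0..}|lborel. bend_weight p t)) at_top"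
    by (rule tendsto_set_lebesgue_integral_at_top[OF _ int]) auto
  moreover have "(LINT t:{0..}|lborel. bend_weight p t) = cp p / 2"
    by (simp add: cp_def bend_weight_def)
  moreover have "(LINT t:{0..b}|lborel. bend_weight p t) = G b" if "b \<ge> 0" for b
  proof -
    have "(bend_weight p has_integral (G b - G 0)) {0..b}"
      using G that by (intro fundamental_theorem_of_calculus)
        (auto simp: has_real_derivative_iff_has_vector_derivative[symmetric] intro: has_field_derivative_at_within)
    moreover have "set_integrable lborel {0..b} (bend_weight p)"
      by (rule set_integrable_subset[OF int]) auto
    ultimately show ?thesis by (simp add: set_borel_integral_eq_integral integral_unique G_def)
  qed
  ultimately have lim: "(G \<longlongrightarrow> cp p / 2) at_top"
    by (subst (asm) tendsto_cong[of _ G]) (auto intro!: eventually_mono[OF eventually_ge_at_top[of 0]])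
  have "\<exists>S\<ge>0. A < G S" if "A < cp p / 2" for A
    using eventually_happens[OF eventually_conj[OF eventually_ge_at_top[of 0] order_tendstoD(1)[OF lim that]]]
    by auto
  then show thesis using that[of G] G odd mono by blast
qed

lemma curvature_integrand_eq:
  fixes p :: real
  assumes "p > 1"
  shows "\<bar>w / (1 + s\<^sup>2) powr (3/2)\<bar> powr p * sqrt (1 + s\<^sup>2) = \<bar>bend_weight p s * w\<bar> powr p"
proof -
  define q where "q = 1 + s\<^sup>2"
  have q: "q > 0" using one_plus_square_pos[of s] by (simp add: q_def)
  have "(q powr (3/2)) powr p = q powr ((3/2 - 1 / (2 * p)) * p) * q powr (1/2)"
    using assms by (simp add: powr_powr powr_add[symmetric] field_simps)
  moreover have "sqrt q = q powr (1/2)" using q by (simp add: powr_half_sqrt)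
  ultimately show ?thesis
    unfolding bend_weight_def q_def[symmetric] using q
    by (simp add: abs_mult powr_mult powr_divide powr_powr)
qed

lemma Ep_eq_integral:
  fixes u w d :: "real \<Rightarrow> real"
  assumes p: "p > 1" and w: "w absolutely_integrable_on {0..1}"
    and wp: "(\<lambda>x. \<bar>w x\<bar> powr p) absolutely_integrable_on {0..1}"
    and d: "\<And>x. x \<in> {0..1} \<Longrightarrow> d x = a + integral {0..x} w"
    and u: "\<And>x. x \<in> {0..1} \<Longrightarrow> (u has_real_derivative d x) (at x within {0..1})"
  shows "(\<lambda>x. \<bar>bend_weight p (d x) * w x\<bar> powr p) absolutely_integrable_on {0..1}"
    and "Ep p u = integral {0..1} (\<lambda>x. \<bar>bend_weight p (d x) * w x\<bar> powr p)"
proof -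
  have wi: "w integrable_on {0..1}" using w by (auto simp: absolutely_integrable_on_def)
  have cd: "continuous_on {0..1} d"
    using indefinite_integral_continuous_1[OF wi]
    by (subst continuous_on_cong[OF refl d]) (auto intro!: continuous_intros)
  define h where "h = (\<lambda>x. bend_weight p (d x) powr p)"
  have ch: "continuous_on {0..1} h"
    unfolding h_def using bend_weight_pos[of p] p
    by (intro continuous_on_powr' continuous_on_compose2[OF continuous_on_bend_weight[of UNIV] cd] continuous_intros)
      (auto simp: less_imp_le)
  have "(\<lambda>x. h x * \<bar>w x\<bar> powr p) absolutely_integrable_on {0..1}"
  proof (rule absolutely_integrable_bounded_measurable_product_real[OF _ _ _ wp])
    show "h \<in> borel_measurable (lebesgue_on {0..1})"
      using ch by (intro continuous_imp_measurable_on_sets_lebesgue) auto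
    show "bounded (h ` {0..1})"
      using ch by (intro compact_imp_bounded compact_continuous_image) auto
  qed auto
  moreover have "(\<lambda>x. h x * \<bar>w x\<bar> powr p) = (\<lambda>x. \<bar>bend_weight p (d x) * w x\<bar> powr p)"
    using bend_weight_pos[of p] by (auto simp: h_def abs_mult powr_mult less_imp_le)
  ultimately show ai: "(\<lambda>x. \<bar>bend_weight p (d x) * w x\<bar> powr p) absolutely_integrable_on {0..1}" by simp
  define N where "N = {0, 1} \<union> {x \<in> {0<..<1}. \<not> ((\<lambda>x. integral {0..x} w) has_real_derivative w x) (at x)}"
  have N: "negligible N"
    unfolding N_def by (intro negligible_Un negligible_not_has_derivative_indefinite_integral[OF wi]) auto
  have du: "deriv u x = d x" if "x \<in> {0<..<1}" for x
    using u[of x] that by (intro DERIV_imp_deriv) (auto simp: at_within_Icc_at)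
  have eq: "\<bar>curv u x\<bar> powr p * sqrt (1 + (deriv u x)\<^sup>2) = \<bar>bend_weight p (d x) * w x\<bar> powr p"
    if x: "x \<in> {0..1} - N" for x
  proof -
    have x01: "x \<in> {0<..<1}" and der: "((\<lambda>x. integral {0..x} w) has_real_derivative w x) (at x)"
      using x by (auto simp: N_def)
    have "((\<lambda>x. a + integral {0..x} w) has_real_derivative w x) (at x)"
      using der by (auto intro!: derivative_eq_intros)
    then have "(deriv u has_real_derivative w x) (at x)"
      by (rule has_field_derivative_transform_within_open[of _ _ _ "{0<..<1}"]) (use x01 du d in auto)
    then have "deriv (deriv u) x = w x" by (rule DERIV_imp_deriv)
    then show ?thesis
      using curvature_integrand_eq[OF p, of "w x" "d x"] du[OF x01] by (simp add: curv_def)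
  qed
  have "(\<lambda>x. \<bar>curv u x\<bar> powr p * sqrt (1 + (deriv u x)\<^sup>2)) absolutely_integrable_on {0..1}"
    by (rule absolutely_integrable_spike[OF ai N eq])
  then have "Ep p u = integral {0..1} (\<lambda>x. \<bar>curv u x\<bar> powr p * sqrt (1 + (deriv u x)\<^sup>2))"
    unfolding Ep_def by (rule set_lebesgue_integral_eq_integral(2))
  also have "\<dots> = integral {0..1} (\<lambda>x. \<bar>bend_weight p (d x) * w x\<bar> powr p)"
    by (rule integral_spike[OF N]) (use eq in auto)
  finally show "Ep p u = integral {0..1} (\<lambda>x. \<bar>bend_weight p (d x) * w x\<bar> powr p)" .
qed

lemma W2p_iff:
  "W2p p u \<longleftrightarrow> (\<exists>a w. w absolutely_integrable_on {0..1} \<and> (\<lambda>x. \<bar>w x\<bar> powr p) absolutely_integrable_on {0..1} \<and>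
      (\<forall>x\<in>{0..1}. (u has_real_derivative (a + integral {0..x} w)) (at x within {0..1})))"
  unfolding W2p_def
proof (rule ex_cong1, rule ex_cong1, rule conj_cong[OF refl], rule conj_cong[OF refl], rule ball_cong[OF refl])
  fix a x :: real and w :: "real \<Rightarrow> real"
  assume "w absolutely_integrable_on {0..1}" "x \<in> {0..1}"
  then have "w absolutely_integrable_on {0..x}"
    by (elim absolutely_integrable_on_subinterval) auto
  from set_lebesgue_integral_eq_integral(2)[OF this]
  show "(u has_real_derivative (a + (LINT t:{0..x}|lebesgue. w t))) (at x within {0..1}) \<longleftrightarrow>
    (u has_real_derivative (a + integral {0..x} w)) (at x within {0..1})" by (simp only:)
qed

lemma symmetric_derivative_antisymmetric:
  fixes u d :: "real \<Rightarrow> real"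
  assumes u: "\<And>x. x \<in> {0..1} \<Longrightarrow> (u has_real_derivative d x) (at x within {0..1})"
    and usym: "\<And>x. x \<in> {0..1} \<Longrightarrow> u x = u (1 - x)" and x: "x \<in> {0..1}"
  shows "d (1 - x) = - d x"
proof -
  have img: "(\<lambda>x. 1 - x) ` {0..1::real} = {0..1}"
    using image_diff_atLeastAtMost[of 1 0 "1::real"] by simp
  have "(u has_real_derivative d (1 - x)) (at (1 - x) within (\<lambda>x. 1 - x) ` {0..1})"
    unfolding img using u[of "1 - x"] x by auto
  from DERIV_image_chain[OF this, of "-1"]
  have "((\<lambda>x. 1 - x) has_real_derivative - 1) (at x within {0..1}) \<Longrightarrow>
      ((\<lambda>x. u (1 - x)) has_real_derivative - d (1 - x)) (at x within {0..1})"
    by (simp add: o_def)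
  moreover have "((\<lambda>x. 1 - x) has_real_derivative - 1) (at x within {0..1})"
    by (auto intro!: derivative_eq_intros)
  ultimately have "((\<lambda>x. u (1 - x)) has_real_derivative - d (1 - x)) (at x within {0..1})" by blast
  then have "(u has_real_derivative - d (1 - x)) (at x within {0..1})"
  proof (rule has_field_derivative_transform_within[of _ _ _ _ 1])
    show "u (1 - y) = u y" if "y \<in> {0..1}" for y using usym[OF that] by (rule sym)
  qed (use x in auto)
  then have "- d (1 - x) = d x"
    using u[OF x] x vector_derivative_unique_within_closed_interval[of 0 1 x u]
    by (auto simp: has_real_derivative_iff_has_vector_derivative)
  then show ?thesis by simp
qed

lemma symmetric_primitive_bound:
  fixes u w d G :: "real \<Rightarrow> real"
  assumes p: "p > 1" and w: "w absolutely_integrable_on {0..1}"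
    and wp: "(\<lambda>x. \<bar>w x\<bar> powr p) absolutely_integrable_on {0..1}"
    and d: "\<And>x. x \<in> {0..1} \<Longrightarrow> d x = a + integral {0..x} w"
    and u: "\<And>x. x \<in> {0..1} \<Longrightarrow> (u has_real_derivative d x) (at x within {0..1})"
    and usym: "\<And>x. x \<in> {0..1} \<Longrightarrow> u x = u (1 - x)" and x: "x \<in> {0..1}"
    and G: "\<And>s. (G has_real_derivative bend_weight p s) (at s)" "\<And>s. G (- s) = - G s"
  shows "(2 * \<bar>G (d x)\<bar>) powr p \<le> Ep p u"
proof -
  define f where "f = (\<lambda>x. bend_weight p (d x) * w x)"
  have ch: "f absolutely_integrable_on {0..1}"
    "\<And>x. x \<in> {0..1} \<Longrightarrow> G (d x) = G (d 0) + integral {0..x} f"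
    unfolding f_def using chain_rule_indefinite_integral[OF w d G(1) continuous_on_bend_weight] by blast+
  have ep: "(\<lambda>x. \<bar>f x\<bar> powr p) absolutely_integrable_on {0..1}"
    "Ep p u = integral {0..1} (\<lambda>x. \<bar>f x\<bar> powr p)"
    unfolding f_def using Ep_eq_integral[OF p w wp d u] by blast+
  have fa: "(\<lambda>x. \<bar>f x\<bar>) integrable_on {0..1}" and fi: "f integrable_on {0..1}"
    using ch(1) by (auto simp: absolutely_integrable_on_def)
  have *: "2 * \<bar>G (d y)\<bar> \<le> integral {0..1} (\<lambda>x. \<bar>f x\<bar>)" if y: "0 \<le> y" "y \<le> 1 - y" for y
  proof -
    have y': "y \<in> {0..1}" "1 - y \<in> {0..1}" using y by auto
    have sub: "{y..1-y} \<subseteq> {0..1}" using y by auto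
    have "G (d (1 - y)) - G (d y) = integral {0..1-y} f - integral {0..y} f"
      using ch(2)[OF y'(1)] ch(2)[OF y'(2)] by simp
    also have "\<dots> = integral {y..1-y} f"
      using Henstock_Kurzweil_Integration.integral_combine[of 0 y "1 - y" f] y
        integrable_on_subinterval[OF fi, of 0 "1 - y"] by auto
    also have "norm \<dots> \<le> integral {y..1-y} (\<lambda>x. \<bar>f x\<bar>)"
      using integrable_on_subinterval[OF fi sub] integrable_on_subinterval[OF fa sub]
      by (intro integral_norm_bound_integral) auto
    also have "\<dots> \<le> integral {0..1} (\<lambda>x. \<bar>f x\<bar>)"
      using integrable_on_subinterval[OF fa sub] fa sub by (intro integral_subset_le) auto
    finally have "\<bar>G (d (1 - y)) - G (d y)\<bar> \<le> integral {0..1} (\<lambda>x. \<bar>f x\<bar>)" by simp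
    moreover have "d (1 - y) = - d y" using symmetric_derivative_antisymmetric[OF u usym y'(1)] .
    ultimately show ?thesis using G(2) by simp
  qed
  have "2 * \<bar>G (d x)\<bar> \<le> integral {0..1} (\<lambda>x. \<bar>f x\<bar>)"
  proof (cases "x \<le> 1 - x")
    case True
    then show ?thesis using * x by auto
  next
    case False
    moreover have "d (1 - x) = - d x" using symmetric_derivative_antisymmetric[OF u usym x] .
    ultimately show ?thesis using *[of "1 - x"] x G(2) by auto
  qed
  then have "(2 * \<bar>G (d x)\<bar>) powr p \<le> (integral {0..1} (\<lambda>x. \<bar>f x\<bar>)) powr p"
    using p by (intro powr_mono2) auto
  also have "\<dots> \<le> integral {0..1} (\<lambda>x. \<bar>f x\<bar> powr p)"
    by (rule powr_integral_le_integral_powr[OF p ch(1) ep(1)])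
  also have "\<dots> = Ep p u" using ep(2) by simp
  finally show ?thesis .
qed

lemma indefinite_integral_composition_density:
  fixes w \<omega> D G G' :: "real \<Rightarrow> real"
  assumes w: "w integrable_on {a..b}" and \<omega>: "\<omega> integrable_on {a..b}"
    and D: "\<And>x. x \<in> {a..b} \<Longrightarrow> D x = c + integral {a..x} w"
    and GD: "\<And>x. x \<in> {a..b} \<Longrightarrow> G (D x) = c' + integral {a..x} \<omega>"
    and G: "\<And>s. (G has_real_derivative G' s) (at s)"
  obtains N where "negligible N" "\<And>x. x \<in> {a..b} - N \<Longrightarrow> G' (D x) * w x = \<omega> x"
proof
  let ?bad = "\<lambda>f. {x \<in> {a<..<b}. \<not> ((\<lambda>x. integral {a..x} f) has_real_derivative f x) (at x)}"
  show "negligible ({a, b} \<union> ?bad w \<union> ?bad \<omega>)"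
    by (intro negligible_Un negligible_not_has_derivative_indefinite_integral w \<omega>) auto
  fix x assume "x \<in> {a..b} - ({a, b} \<union> ?bad w \<union> ?bad \<omega>)"
  then have x: "x \<in> {a<..<b}"
    and dw: "((\<lambda>x. integral {a..x} w) has_real_derivative w x) (at x)"
    and d\<omega>: "((\<lambda>x. integral {a..x} \<omega>) has_real_derivative \<omega> x) (at x)" by auto
  have "((\<lambda>x. c + integral {a..x} w) has_real_derivative w x) (at x)"
    using dw by (auto intro!: derivative_eq_intros)
  then have "(D has_real_derivative w x) (at x)"
    by (rule has_field_derivative_transform_within_open[of _ _ _ "{a<..<b}"]) (use x D in auto)
  from DERIV_chain2[where f = G and g = D, OF G this]
  have "((\<lambda>x. G (D x)) has_real_derivative G' (D x) * w x) (at x)" .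
  moreover have "((\<lambda>x. c' + integral {a..x} \<omega>) has_real_derivative \<omega> x) (at x)"
    using d\<omega> by (auto intro!: derivative_eq_intros)
  then have "((\<lambda>x. G (D x)) has_real_derivative \<omega> x) (at x)"
    by (rule has_field_derivative_transform_within_open[of _ _ _ "{a<..<b}"]) (use x GD in auto)
  ultimately show "G' (D x) * w x = \<omega> x" by (rule DERIV_unique)
qed

lemma bend_weight_primitive_Lipschitz:
  fixes G :: "real \<Rightarrow> real"
  assumes p: "p > 1" and G: "\<And>s. (G has_real_derivative bend_weight p s) (at s)"
  shows "\<bar>G s - G t\<bar> \<le> \<bar>s - t\<bar>"
proof -
  have *: "\<bar>bend_weight p z\<bar> \<le> 1" for z
    using bend_weight_antimono[OF p, of 0 z] bend_weight_pos[of p z] by (simp add: bend_weight_def[of p 0])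
  have "norm (G s - G t) \<le> 1 * norm (s - t)"
    by (rule field_differentiable_bound[of UNIV G "bend_weight p"]) (use G * in auto)
  then show ?thesis by simp
qed

lemma Ep_nonneg: "Ep p u \<ge> 0"
  unfolding Ep_def set_lebesgue_integral_def by (intro Bochner_Integration.integral_nonneg) auto

lemma cp_nonneg: "cp p \<ge> 0"
  unfolding cp_def set_lebesgue_integral_def
  by (intro mult_nonneg_nonneg Bochner_Integration.integral_nonneg) auto

lemma abs_le_of_odd_strict_mono:
  fixes G :: "real \<Rightarrow> real"
  assumes "strict_mono G" "\<And>s. G (- s) = - G s" "\<bar>G s\<bar> < G S"
  shows "\<bar>s\<bar> \<le> S"
proof -
  have "G s < G S" "G (- S) < G s" using assms(2)[of S] assms(3) by (auto simp: abs_less_iff)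
  then show ?thesis using strict_mono_less[OF assms(1)] by (simp add: abs_le_iff)
qed

theorem theorem6p1:
  fixes p :: real and \<psi> :: "real \<Rightarrow> real"
  assumes "p > 1"
    and "continuous_on {0..1} \<psi>"
    and "\<psi> 0 < 0" and "\<psi> 1 < 0"
    and "\<exists>x0\<in>{0<..<1}. \<psi> x0 > 0"
    and "(INF v\<in>Msym p \<psi>. ereal (Ep p v)) < ereal (cp p powr p)"
  shows "\<exists>u\<in>Msym p \<psi>. \<forall>v\<in>Msym p \<psi>. Ep p u \<le> Ep p v"
proof -
  note p = \<open>p > 1\<close>
  obtain v0 where v0: "v0 \<in> Msym p \<psi>" "Ep p v0 < cp p powr p"
    using assms(6) by (auto simp: INF_less_iff)
  have cp: "cp p > 0"
    using v0(2) Ep_nonneg[of p v0] cp_nonneg[of p] by (cases "cp p = 0") auto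
  define L where "L = Inf (Ep p ` Msym p \<psi>)"
  have bdd: "bdd_below (Ep p ` Msym p \<psi>)" by (rule bdd_belowI[of _ 0]) (auto simp: Ep_nonneg)
  have L_le: "L \<le> Ep p v" if "v \<in> Msym p \<psi>" for v
    unfolding L_def using that bdd by (intro cInf_lower) auto
  define Q where "Q = Ep p v0"
  have "\<exists>v\<in>Msym p \<psi>. Ep p v \<le> Q \<and> Ep p v \<le> L + 1 / real (Suc n)" for n
  proof -
    obtain v where v: "v \<in> Msym p \<psi>" "Ep p v < L + 1 / real (Suc n)"
      using cInf_lessD[of "Ep p ` Msym p \<psi>" "L + 1 / real (Suc n)"] v0 unfolding L_def by auto
    show ?thesis
    proof (cases "Ep p v \<le> Q")
      case True
      then show ?thesis using v by (intro bexI[of _ v]) auto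
    next
      case False
      then show ?thesis using v v0 by (intro bexI[of _ v0]) (auto simp: Q_def)
    qed
  qed
  then obtain u where u: "\<And>n. u n \<in> Msym p \<psi>" "\<And>n. Ep p (u n) \<le> Q" "\<And>n. Ep p (u n) \<le> L + 1 / real (Suc n)"
    by metis
  define P where "P = (\<lambda>n a w. w absolutely_integrable_on {0..1} \<and>
      (\<lambda>x. \<bar>w x\<bar> powr p) absolutely_integrable_on {0..1} \<and>
      (\<forall>x\<in>{0..1}. (u n has_real_derivative (a + integral {0..x} w)) (at x within {0..1})))"
  have "\<exists>a w. P n a w" for n
    using u(1)[of n] unfolding P_def Msym_def Mset_def W2p_W1p0_def W2p_iff by simp
  then obtain a w where P: "\<And>n. P n (a n) (w n)" by metis
  have w: "w n absolutely_integrable_on {0..1}"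
    and wp: "(\<lambda>x. \<bar>w n x\<bar> powr p) absolutely_integrable_on {0..1}"
    and du: "x \<in> {0..1} \<Longrightarrow> (u n has_real_derivative (a n + integral {0..x} (w n))) (at x within {0..1})"
    for n x
    using P[of n] unfolding P_def by blast+
  have usym: "u n x = u n (1 - x)" and u\<psi>: "\<psi> x \<le> u n x" and u0: "u n 0 = 0" and u1: "u n 1 = 0"
    if "x \<in> {0..1}" for n x
    using u(1)[of n] that unfolding Msym_def Mset_def W2p_W1p0_def by blast+
  define d where "d = (\<lambda>n x. a n + integral {0..x} (w n))"
  define f where "f = (\<lambda>n x. bend_weight p (d n x) * w n x)"
  obtain G where G: "\<And>s. (G has_real_derivative bend_weight p s) (at s)" "\<And>s. G (- s) = - G s"
    "strict_mono G" "\<And>A. A < cp p / 2 \<Longrightarrow> \<exists>S\<ge>0. A < G S"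
    using bend_weight_primitive[OF p cp] by blast
  have fp: "(\<lambda>x. \<bar>f n x\<bar> powr p) absolutely_integrable_on {0..1}"
    and Epf: "Ep p (u n) = integral {0..1} (\<lambda>x. \<bar>f n x\<bar> powr p)" for n
    using Ep_eq_integral[of p "w n" "d n" "a n" "u n"] p w wp du by (auto simp: f_def d_def)
  have f: "f n absolutely_integrable_on {0..1}"
    and Gd: "x \<in> {0..1} \<Longrightarrow> G (d n x) = G (d n 0) + integral {0..x} (f n)" for n x
    using chain_rule_indefinite_integral[of 0 1 "w n" "d n" "a n" G "bend_weight p"] w G(1)
      continuous_on_bend_weight by (auto simp: f_def d_def)

  have Q0: "Q \<ge> 0" unfolding Q_def by (rule Ep_nonneg)
  have "Q powr (1 / p) < (cp p powr p) powr (1 / p)"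
    using v0(2) Q0 p by (intro powr_less_mono2) (auto simp: Q_def)
  then have "Q powr (1 / p) / 2 < cp p / 2" using p cp by (simp add: powr_powr)
  then obtain S where S: "S \<ge> 0" "Q powr (1 / p) / 2 < G S" using G(4) by blast
  have dS: "\<bar>d n x\<bar> \<le> S" if x: "x \<in> {0..1}" for n x
  proof -
    have "(2 * \<bar>G (d n x)\<bar>) powr p \<le> Ep p (u n)"
      by (rule symmetric_primitive_bound[of p "w n" "d n" "a n" "u n" x G, OF p w wp _ _ usym x G(1,2)])
        (use du in \<open>auto simp: d_def\<close>)
    also have "\<dots> \<le> Q" by (rule u)
    finally have "((2 * \<bar>G (d n x)\<bar>) powr p) powr (1 / p) \<le> Q powr (1 / p)" using p by (intro powr_mono2) auto
    then have "2 * \<bar>G (d n x)\<bar> \<le> Q powr (1 / p)" using p by (simp add: powr_powr)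
    then have "\<bar>G (d n x)\<bar> < G S" using S by linarith
    then show ?thesis by (rule abs_le_of_odd_strict_mono[OF G(3,2)])
  qed
  define \<kappa> where "\<kappa> = bend_weight p S"
  have \<kappa>: "\<kappa> > 0" unfolding \<kappa>_def by (rule bend_weight_pos)
  define C where "C = Q / \<kappa> powr p"
  have wC: "integral {0..1} (\<lambda>x. \<bar>w n x\<bar> powr p) \<le> C" for n
  proof -
    have "\<kappa> powr p * integral {0..1} (\<lambda>x. \<bar>w n x\<bar> powr p) = integral {0..1} (\<lambda>x. \<kappa> powr p * \<bar>w n x\<bar> powr p)"
      by simp
    also have "\<dots> \<le> integral {0..1} (\<lambda>x. \<bar>f n x\<bar> powr p)"
    proof (rule integral_le)
      show "(\<lambda>x. \<kappa> powr p * \<bar>w n x\<bar> powr p) integrable_on {0..1}" "(\<lambda>x. \<bar>f n x\<bar> powr p) integrable_on {0..1}"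
        using wp[of n] fp[of n] by (auto simp: absolutely_integrable_on_def intro: integrable_on_mult_right)
      fix x :: real assume "x \<in> {0..1}"
      then have "\<kappa> \<le> bend_weight p (d n x)" unfolding \<kappa>_def using dS[of x n] S(1) by (intro bend_weight_antimono p) auto
      then have "(\<kappa> * \<bar>w n x\<bar>) powr p \<le> \<bar>f n x\<bar> powr p"
        unfolding f_def abs_mult using \<kappa> p by (intro powr_mono2 mult_mono) auto
      then show "\<kappa> powr p * \<bar>w n x\<bar> powr p \<le> \<bar>f n x\<bar> powr p" using \<kappa> by (simp add: powr_mult)
    qed
    also have "\<dots> \<le> Q" using u(2)[of n] Epf by simp
    finally show ?thesis using \<kappa> by (simp add: C_def field_simps)
  qed
  have C0: "C \<ge> 0" using Q0 by (simp add: C_def)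

  have equi: "\<exists>\<delta>>0. \<forall>n y. y \<in> {0..1} \<and> norm (x - y) < \<delta> \<longrightarrow> norm (d n x - d n y) < e"
    if x: "x \<in> {0..1}" and e: "e > 0" for x e
  proof -
    define \<epsilon> where "\<epsilon> = e / (2 * (C + 1))"
    have \<epsilon>: "\<epsilon> > 0" "\<epsilon> * C < e / 2" using e C0 by (auto simp: \<epsilon>_def field_simps)
    define R where "R = (1 / \<epsilon>) powr (1 / (p - 1))"
    have R: "R > 0" using \<epsilon> by (simp add: R_def)
    have "norm (d n x - d n y) < e" if y: "y \<in> {0..1}" "norm (x - y) < e / (2 * R)" for n y
    proof -
      have "\<bar>d n x - d n y\<bar> \<le> \<epsilon> * C + R * \<bar>x - y\<bar>"
        using equicontinuous_indefinite_integral[OF p \<epsilon>(1) w wp wC x y(1)] by (simp add: d_def R_def)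
      moreover have "R * \<bar>x - y\<bar> < e / 2" using y(2) R by (simp add: field_simps)
      ultimately show ?thesis using \<epsilon>(2) by simp
    qed
    then show ?thesis using e R by (intro exI[of _ "e / (2 * R)"]) auto
  qed
  obtain D r where D: "continuous_on {0..1} D" "strict_mono (r :: nat \<Rightarrow> nat)"
    "\<And>e. 0 < e \<Longrightarrow> \<exists>N. \<forall>n x. n \<ge> N \<and> x \<in> {0..1} \<longrightarrow> norm (d (r n) x - D x) < e"
    using Arzela_Ascoli[of "{0..1}" d S, OF compact_Icc _ equi] dS unfolding real_norm_def by blast
  have D': "\<forall>\<^sub>F n in sequentially. \<forall>x\<in>{0..1}. \<bar>d (r n) x - D x\<bar> < e" if "e > 0" for e
    using D(3)[OF that] unfolding eventually_sequentially real_norm_def by blast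
  have lim_w: "uniform_limit {0..1} (\<lambda>n x. integral {0..x} (w (r n))) (\<lambda>x. D x - D 0) sequentially"
  proof (rule uniform_limitI)
    fix e :: real assume "e > 0"
    then have "e / 2 > 0" by simp
    from D'[OF this] show "\<forall>\<^sub>F n in sequentially. \<forall>x\<in>{0..1}. dist (integral {0..x} (w (r n))) (D x - D 0) < e"
    proof eventually_elim
      case (elim n)
      show ?case
      proof
        fix x :: real assume x: "x \<in> {0..1}"
        have "integral {0..x} (w (r n)) = d (r n) x - d (r n) 0" by (simp add: d_def)
        moreover have "\<bar>d (r n) x - D x\<bar> < e / 2" "\<bar>d (r n) 0 - D 0\<bar> < e / 2" using elim x by auto
        ultimately show "dist (integral {0..x} (w (r n))) (D x - D 0) < e" unfolding dist_real_def by argo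
      qed
    qed
  qed
  have lim_f: "uniform_limit {0..1} (\<lambda>n x. integral {0..x} (f (r n))) (\<lambda>x. G (D x) - G (D 0)) sequentially"
  proof (rule uniform_limitI)
    fix e :: real assume "e > 0"
    then have "e / 2 > 0" by simp
    from D'[OF this] show "\<forall>\<^sub>F n in sequentially. \<forall>x\<in>{0..1}. dist (integral {0..x} (f (r n))) (G (D x) - G (D 0)) < e"
    proof eventually_elim
      case (elim n)
      show ?case
      proof
        fix x :: real assume x: "x \<in> {0..1}"
        have "integral {0..x} (f (r n)) = G (d (r n) x) - G (d (r n) 0)" using Gd[OF x, of "r n"] by simp
        moreover have "\<bar>d (r n) x - D x\<bar> < e / 2" "\<bar>d (r n) 0 - D 0\<bar> < e / 2" using elim x by auto
        then have "\<bar>G (d (r n) x) - G (D x)\<bar> < e / 2" "\<bar>G (d (r n) 0) - G (D 0)\<bar> < e / 2"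
          using bend_weight_primitive_Lipschitz[OF p G(1)] by (meson le_less_trans)+
        ultimately show "dist (integral {0..x} (f (r n))) (G (D x) - G (D 0)) < e" unfolding dist_real_def by argo
      qed
    qed
  qed
  obtain W where W: "W absolutely_integrable_on {0..1}" "(\<lambda>x. \<bar>W x\<bar> powr p) absolutely_integrable_on {0..1}"
    "\<And>x. x \<in> {0..1} \<Longrightarrow> integral {0..x} W = D x - D 0"
    using powr_energy_lower_semicontinuous[where w = "\<lambda>n. w (r n)", OF p w wp wC tendsto_const lim_w] by blast
  have "(\<lambda>n. L + 1 / real (Suc n)) \<longlonglongrightarrow> L + 0"
    by (intro tendsto_intros) (use lim_inverse_n' LIMSEQ_Suc in blast)
  from LIMSEQ_subseq_LIMSEQ[OF this D(2)]
  have limE: "(\<lambda>n. L + 1 / real (Suc (r n))) \<longlonglongrightarrow> L" by (simp add: o_def)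
  have fE: "integral {0..1} (\<lambda>x. \<bar>f (r n) x\<bar> powr p) \<le> L + 1 / real (Suc (r n))" for n
    using u(3)[of "r n"] Epf by simp
  obtain \<omega> where \<omega>: "\<omega> absolutely_integrable_on {0..1}"
    "\<And>x. x \<in> {0..1} \<Longrightarrow> integral {0..x} \<omega> = G (D x) - G (D 0)" "integral {0..1} (\<lambda>x. \<bar>\<omega> x\<bar> powr p) \<le> L"
    using powr_energy_lower_semicontinuous[where w = "\<lambda>n. f (r n)", OF p f fp fE limE lim_f] by blast
  have "W integrable_on {0..1}" "\<omega> integrable_on {0..1}"
    using W(1) \<omega>(1) by (auto simp: absolutely_integrable_on_def)
  then obtain N where N: "negligible N" "\<And>x. x \<in> {0..1} - N \<Longrightarrow> bend_weight p (D x) * W x = \<omega> x"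
    by (rule indefinite_integral_composition_density[of W 0 1 \<omega> D "D 0" G "G (D 0)" "bend_weight p"])
      (use W(3) \<omega>(2) G(1) in auto)

  have "\<exists>g. \<forall>x\<in>{0..1}. (\<lambda>n. u (r n) x) \<longlonglongrightarrow> g x \<and> (g has_derivative (\<lambda>h. D x * h)) (at x within {0..1})"
  proof (rule has_derivative_sequence[where f' = "\<lambda>n x h. d (r n) x * h" and ?x0.0 = 0 and l = 0])
    show "(u (r n) has_derivative (\<lambda>h. d (r n) x * h)) (at x within {0..1})" if "x \<in> {0..1}" for n x
      using du[OF that, of "r n"] by (simp add: d_def has_field_derivative_def)
    show "\<forall>\<^sub>F n in sequentially. \<forall>x\<in>{0..1}. \<forall>h. norm (d (r n) x * h - D x * h) \<le> e * norm h"
      if "e > 0" for e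
      using D'[OF that]
      by eventually_elim (auto simp: left_diff_distrib[symmetric] abs_mult intro!: mult_right_mono intro: less_imp_le)
    show "(\<lambda>n. u (r n) 0) \<longlonglongrightarrow> 0" using u0[of 0] by simp
  qed auto
  then obtain U where lim: "\<And>x. x \<in> {0..1} \<Longrightarrow> (\<lambda>n. u (r n) x) \<longlonglongrightarrow> U x"
    and U: "\<And>x. x \<in> {0..1} \<Longrightarrow> (U has_real_derivative D x) (at x within {0..1})"
    unfolding has_field_derivative_def by blast
  have DW: "D x = D 0 + integral {0..x} W" if "x \<in> {0..1}" for x using W(3)[OF that] by simp
  have "U \<in> Msym p \<psi>"
    unfolding Msym_def Mset_def W2p_W1p0_def W2p_iff
  proof (intro CollectI conjI ballI)
    show "\<exists>a w. w absolutely_integrable_on {0..1} \<and> (\<lambda>x. \<bar>w x\<bar> powr p) absolutely_integrable_on {0..1} \<and>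
      (\<forall>x\<in>{0..1}. (U has_real_derivative (a + integral {0..x} w)) (at x within {0..1}))"
      by (intro exI[of _ "D 0"] exI[of _ W] conjI ballI W(1,2)) (simp only: DW[symmetric] U)
    show "U 0 = 0" using LIMSEQ_unique[OF lim[of 0]] u0[of 0] by simp
    show "U 1 = 0" using LIMSEQ_unique[OF lim[of 1]] u1[of 0] by simp
    fix x :: real assume x: "x \<in> {0..1}"
    show "\<psi> x \<le> U x" using lim[OF x] u\<psi>[OF x] by (auto intro: LIMSEQ_le_const)
    show "U x = U (1 - x)"
      using LIMSEQ_unique[OF lim[OF x], of "U (1 - x)"] lim[of "1 - x"] x by (simp add: usym[OF x])
  qed
  moreover have "Ep p U \<le> L"
  proof -
    have "Ep p U = integral {0..1} (\<lambda>x. \<bar>bend_weight p (D x) * W x\<bar> powr p)"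
      by (rule Ep_eq_integral(2)[where a = "D 0", OF p W(1,2)]) (fact DW U)+
    also have "\<dots> = integral {0..1} (\<lambda>x. \<bar>\<omega> x\<bar> powr p)"
      by (rule integral_spike[OF N(1)]) (use N(2) in auto)
    finally show ?thesis using \<omega>(3) by simp
  qed
  ultimately show ?thesis using order_trans[OF _ L_le] by blast
qed

end
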